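(* Let $1<p\le q<\infty$ and let $g$ be a (not necessarily bounded) function on $\mathbb R$ admitting a $(q,p')$-factorization, i.e. $g=g_-r^kg_+$ with $k\in\mathbb Z$ and $$g_-\in\mathcal H_q^-,\quad g_-^{-1}\in\mathcal H_{p'}^-,\quad g_+\in\mathcal H_{p'}^+,\quad g_+^{-1}\in\mathcal H_q^+ .$$ Consider the Toeplitz operator $T_g$ in $H_p^+$. (i) If $g_-\in\mathcal H_p^-$ and $g_+^{-1}\in\mathcal H_p^+$, then $\dim\ker T_g=0$ if $k\ge 0$, and $\dim\ker T_g=|k|$ if $k<0$; in the latter case $\ker T_g=g_+^{-1}K_{r^{|k|}}$. (ii) If $g_-\notin\mathcal H_p^-$ or $g_+^{-1}\notin\mathcal H_p^+$, then $\dim\ker T_g=0$ if $k\ge -1$, and $\dim\ker T_g=|k|-1$ if $k\le -2$; in the latter case $\ker T_g=\frac{g_+^{-1}}{\xi+i}K_{r^{|k|-1}}$.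
   Context: $p'$ is defined by $\frac1p+\frac1{p'}=1$. $L_p=L^p(\mathbb R)$; $H_p^+=H^p(\mathbb C^+)$ and $H_p^-=\overline{H_p^+}=H^p(\mathbb C^-)$ are the Hardy spaces of the upper and lower half-planes, identified with closed subspaces of $L_p$ via boundary values. $\mathcal H_p^{\pm}=\{(\xi\pm i)f: f\in H_p^{\pm}\}$ and $r(\xi)=\frac{\xi-i}{\xi+i}$. The (possibly unbounded) Toeplitz operator $T_g$ in $H_p^+$ has domain $D(T_g)=\{\phi_+\in H_p^+: g\phi_+\in L_p\}$ and $T_g\phi_+=P^+(g\phi_+)$, where $P^+$ is the projection of $L_p$ onto $H_p^+$ parallel to $H_p^-$; thus $\ker T_g=\{\phi_+\in H_p^+: g\phi_+\in H_p^-\}$. For $n\in\mathbb N$, $K_{r^n}=\operatorname{span}\left\{\frac1{\xi+i}\left(\frac{\xi-i}{\xi+i}\right)^j: j=0,\dots,n-1\right\}$. *)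

theory Defs
  imports "HOL-Analysis.Analysis"
begin

section \<open>Measurable functions on the real line modulo null sets\<close>

text \<open>Borel representatives lose nothing: every Lebesgue measurable function agrees almost
  everywhere with a Borel one.\<close>

definition ae_rel :: "(real \<Rightarrow> complex) \<Rightarrow> (real \<Rightarrow> complex) \<Rightarrow> bool" where
  "ae_rel f g \<longleftrightarrow>
     f \<in> borel_measurable lborel \<and> g \<in> borel_measurable lborel \<and> (AE x in lborel. f x = g x)"

lemma ae_rel_part_equivp: "part_equivp ae_rel"
proof (rule part_equivpI)
  show "\<exists>x. ae_rel x x"
    by (rule exI[of _ "\<lambda>_. 0"]) (simp add: ae_rel_def)
  show "symp ae_rel"
    by (rule sympI) (auto simp: ae_rel_def elim: AE_mp)
  show "transp ae_rel"
  proof (rule transpI)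
    fix f g h assume "ae_rel f g" "ae_rel g h"
    then show "ae_rel f h"
      unfolding ae_rel_def by (auto elim: eventually_elim2)
  qed
qed

quotient_type mfun = "real \<Rightarrow> complex" / partial: ae_rel
  by (rule ae_rel_part_equivp)

instantiation mfun :: comm_ring_1
begin

lift_definition zero_mfun :: mfun is "\<lambda>_. 0"
  by (simp add: ae_rel_def)

lift_definition one_mfun :: mfun is "\<lambda>_. 1"
  by (simp add: ae_rel_def)

lift_definition plus_mfun :: "mfun \<Rightarrow> mfun \<Rightarrow> mfun" is "\<lambda>f g x. f x + g x"
  unfolding ae_rel_def by (auto elim: eventually_elim2)

lift_definition minus_mfun :: "mfun \<Rightarrow> mfun \<Rightarrow> mfun" is "\<lambda>f g x. f x - g x"
  unfolding ae_rel_def by (auto elim: eventually_elim2)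

lift_definition uminus_mfun :: "mfun \<Rightarrow> mfun" is "\<lambda>f x. - f x"
  unfolding ae_rel_def by auto

lift_definition times_mfun :: "mfun \<Rightarrow> mfun \<Rightarrow> mfun" is "\<lambda>f g x. f x * g x"
  unfolding ae_rel_def by (auto elim: eventually_elim2)

instance
proof
  show "(0::mfun) \<noteq> 1"
  proof transfer
    have "\<not> (AE x::real in lborel. False)"
      by (simp add: AE_iff_null null_sets_def)
    then show "\<not> ae_rel (\<lambda>_. 0) (\<lambda>_. 1)"
      by (simp add: ae_rel_def)
  qed
qed (transfer; auto simp: ae_rel_def algebra_simps)+

end

text \<open>The inverse is pointwise, with value 0 where the function vanishes.\<close>

instantiation mfun :: inverse
begin

lift_definition inverse_mfun :: "mfun \<Rightarrow> mfun" is "\<lambda>f x. inverse (f x)"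
  unfolding ae_rel_def by auto

definition divide_mfun :: "mfun \<Rightarrow> mfun \<Rightarrow> mfun" where
  "divide_mfun f g = f * inverse g"

instance ..

end

lift_definition const_mf :: "complex \<Rightarrow> mfun" is "\<lambda>c _. c"
  by (simp add: ae_rel_def)

lift_definition xi :: mfun is "\<lambda>x. complex_of_real x"
  by (simp add: ae_rel_def)

lift_definition cnj_mf :: "mfun \<Rightarrow> mfun" is "\<lambda>f x. cnj (f x)"
  unfolding ae_rel_def
  by (auto intro!: borel_measurable_continuous_on[where f = cnj] continuous_intros)

lift_definition nonzero_ae :: "mfun \<Rightarrow> bool" is "\<lambda>f. AE x in lborel. f x \<noteq> 0"
  unfolding ae_rel_def
proof (elim conjE)
  fix f g :: "real \<Rightarrow> complex"
  assume "AE x in lborel. f x = g x"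
  then have "AE x in lborel. (f x \<noteq> 0) = (g x \<noteq> 0)"
    by eventually_elim simp
  then show "(AE x in lborel. f x \<noteq> 0) = (AE x in lborel. g x \<noteq> 0)"
    by (rule eventually_subst)
qed

definition scale_mf :: "complex \<Rightarrow> mfun \<Rightarrow> mfun" where
  "scale_mf c f = const_mf c * f"

interpretation mf: vector_space scale_mf
  by unfold_locales (unfold scale_mf_def, (transfer; auto simp: ae_rel_def algebra_simps)+)

text \<open>Being finite-dimensional is required separately, since the library's dimension of an
  infinite-dimensional space is 0.\<close>

definition has_dimension :: "mfun set \<Rightarrow> nat \<Rightarrow> bool" where
  "has_dimension V n \<longleftrightarrow> (\<exists>B. finite B \<and> V = mf.span B) \<and> mf.dim V = n"


section \<open>Lebesgue and Hardy spaces\<close>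

lift_definition mem_Lp :: "real \<Rightarrow> mfun \<Rightarrow> bool" is
  "\<lambda>p f. (\<integral>\<^sup>+x. ennreal (norm (f x) powr p) \<partial>lborel) < \<infinity>"
  unfolding ae_rel_def
proof (elim conjE)
  fix p :: real and f g :: "real \<Rightarrow> complex"
  assume ae: "AE x in lborel. f x = g x"
  have "(\<integral>\<^sup>+x. ennreal (norm (f x) powr p) \<partial>lborel) = (\<integral>\<^sup>+x. ennreal (norm (g x) powr p) \<partial>lborel)"
    by (rule nn_integral_cong_AE) (use ae in eventually_elim, simp)
  then show "((\<integral>\<^sup>+x. ennreal (norm (f x) powr p) \<partial>lborel) < \<infinity>) =
             ((\<integral>\<^sup>+x. ennreal (norm (g x) powr p) \<partial>lborel) < \<infinity>)"
    by simp
qed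

definition Lp :: "real \<Rightarrow> mfun set" where
  "Lp p = {f. mem_Lp p f}"

definition hardy_fun :: "real \<Rightarrow> (complex \<Rightarrow> complex) \<Rightarrow> bool" where
  "hardy_fun p F \<longleftrightarrow>
     F holomorphic_on {z. Im z > 0} \<and>
     (SUP y\<in>{0<..}. \<integral>\<^sup>+x. ennreal (norm (F (Complex x y)) powr p) \<partial>lborel) < \<infinity>"

definition nontangential_limit :: "(complex \<Rightarrow> complex) \<Rightarrow> real \<Rightarrow> complex \<Rightarrow> bool" where
  "nontangential_limit F x l \<longleftrightarrow>
     (\<forall>a>0. (F \<longlongrightarrow> l) (at (complex_of_real x) within {z. Im z > 0 \<and> \<bar>Re z - x\<bar> < a * Im z}))"

lift_definition boundary_value :: "(complex \<Rightarrow> complex) \<Rightarrow> mfun \<Rightarrow> bool" is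
  "\<lambda>F f. AE x in lborel. nontangential_limit F x (f x)"
  unfolding ae_rel_def
proof (elim conjE)
  fix F :: "complex \<Rightarrow> complex" and f g :: "real \<Rightarrow> complex"
  assume "AE x in lborel. f x = g x"
  then have "AE x in lborel. nontangential_limit F x (f x) = nontangential_limit F x (g x)"
    by eventually_elim simp
  then show "(AE x in lborel. nontangential_limit F x (f x)) =
             (AE x in lborel. nontangential_limit F x (g x))"
    by (rule eventually_subst)
qed

definition hardy_plus :: "real \<Rightarrow> mfun set" where
  "hardy_plus p = {f. f \<in> Lp p \<and> (\<exists>F. hardy_fun p F \<and> boundary_value F f)}"

definition hardy_minus :: "real \<Rightarrow> mfun set" where
  "hardy_minus p = cnj_mf ` hardy_plus p"

definition xi_plus_i :: mfun where
  "xi_plus_i = xi + const_mf \<i>"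

definition xi_minus_i :: mfun where
  "xi_minus_i = xi - const_mf \<i>"

definition cal_hardy_plus :: "real \<Rightarrow> mfun set" where
  "cal_hardy_plus p = (\<lambda>f. xi_plus_i * f) ` hardy_plus p"

definition cal_hardy_minus :: "real \<Rightarrow> mfun set" where
  "cal_hardy_minus p = (\<lambda>f. xi_minus_i * f) ` hardy_minus p"

definition r_mf :: mfun where
  "r_mf = xi_minus_i / xi_plus_i"

definition K_r :: "nat \<Rightarrow> mfun set" where
  "K_r n = mf.span {(1 / xi_plus_i) * r_mf ^ j | j. j < n}"


section \<open>Toeplitz operators and factorization\<close>

text \<open>The projection onto \<open>hardy_plus p\<close> parallel to \<open>hardy_minus p\<close>, given by its graph:
  \<open>riesz_projection p f u\<close> says that \<open>u\<close> is the \<open>hardy_plus\<close> component of \<open>f\<close>.\<close>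

definition riesz_projection :: "real \<Rightarrow> mfun \<Rightarrow> mfun \<Rightarrow> bool" where
  "riesz_projection p f u \<longleftrightarrow> f \<in> Lp p \<and> u \<in> hardy_plus p \<and> f - u \<in> hardy_minus p"

definition toeplitz_domain :: "real \<Rightarrow> mfun \<Rightarrow> mfun set" where
  "toeplitz_domain p g = {\<phi>. \<phi> \<in> hardy_plus p \<and> g * \<phi> \<in> Lp p}"

text \<open>The unbounded operator, as its graph.\<close>

definition toeplitz :: "real \<Rightarrow> mfun \<Rightarrow> (mfun \<times> mfun) set" where
  "toeplitz p g = {(\<phi>, \<psi>). \<phi> \<in> toeplitz_domain p g \<and> riesz_projection p (g * \<phi>) \<psi>}"

definition toeplitz_ker :: "real \<Rightarrow> mfun \<Rightarrow> mfun set" where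
  "toeplitz_ker p g = {\<phi>. (\<phi>, 0) \<in> toeplitz p g}"

lemma zero_mem_hardy_plus: "0 \<in> hardy_plus p"
proof -
  have "mem_Lp p 0"
    by transfer simp
  moreover have "boundary_value (\<lambda>_. 0) 0"
    by transfer (simp add: nontangential_limit_def)
  moreover have "hardy_fun p (\<lambda>_. 0)"
    by (simp add: hardy_fun_def)
  ultimately show ?thesis
    unfolding hardy_plus_def Lp_def by blast
qed

lemma mem_Lp_cnj: "mem_Lp p f \<Longrightarrow> mem_Lp p (cnj_mf f)"
  by transfer simp

lemma toeplitz_ker_eq:
  "toeplitz_ker p g = {\<phi> \<in> hardy_plus p. g * \<phi> \<in> hardy_minus p}"
proof -
  have "f \<in> Lp p" if "f \<in> hardy_minus p" for f
    using that mem_Lp_cnj unfolding hardy_minus_def hardy_plus_def Lp_def by blast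
  then show ?thesis
    unfolding toeplitz_ker_def toeplitz_def toeplitz_domain_def riesz_projection_def
    using zero_mem_hardy_plus by auto
qed

text \<open>The factorization \<open>g = gm r\<^sup>k gp\<close>.  The factors are required to be nonzero almost everywhere,
  so that \<open>inverse gm\<close> and \<open>inverse gp\<close> are genuine reciprocals (otherwise \<open>gm = 0\<close> would qualify).\<close>

definition pq_factorization ::
  "real \<Rightarrow> real \<Rightarrow> mfun \<Rightarrow> mfun \<Rightarrow> int \<Rightarrow> mfun \<Rightarrow> bool" where
  "pq_factorization q s g gm k gp \<longleftrightarrow>
     g = gm * (r_mf powi k) * gp \<and>
     nonzero_ae gm \<and> nonzero_ae gp \<and>
     gm \<in> cal_hardy_minus q \<and> inverse gm \<in> cal_hardy_minus s \<and>
     gp \<in> cal_hardy_plus s \<and> inverse gp \<in> cal_hardy_plus q"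

end

theory Submission
  imports Defs "HOL-Complex_Analysis.Complex_Analysis"
begin

text \<open>Write \<open>g\<^sub>+ = (\<xi> + \<i>) h\<close>, \<open>g\<^sub>+\<inverse> = (\<xi> + \<i>) u\<close> and \<open>g\<^sub>- = (\<xi> - \<i>) v\<close>.  If \<open>\<phi>\<close> lies in the kernel, then
  \<open>h \<phi>\<close> is a product of an \<open>H\<^sub>p\<^sup>+\<close> and an \<open>H\<^sub>p\<^sub>'\<^sup>+\<close> function, and \<open>r\<^sup>k\<^sup>-\<^sup>1 h \<phi>\<close> is the conjugate of
  such a product.  Comparing Cauchy integrals gives \<open>h \<phi> = Q(r) / (\<xi> + \<i>)\<close> with a polynomial \<open>Q\<close> of degree
  at most \<open>-k\<close>; integrability forces \<open>Q(1) = 0\<close>, hence \<open>\<phi> = u Q\<^sub>1(r)\<close> with \<open>degree Q\<^sub>1 < -k\<close>.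
  Conversely \<open>u Q\<^sub>1(r)\<close> lies in the kernel if and only if \<open>Q\<^sub>1(1) = 0\<close> or both \<open>u \<in> H\<^sub>p\<^sup>+\<close> and
  \<open>v \<in> H\<^sub>p\<^sup>-\<close>: the point \<open>1\<close> is the value of \<open>r\<close> at infinity, the only place where the classes
  \<open>H\<^sub>p\<close> and \<open>H\<^sub>q\<close> (\<open>p \<le> q\<close>) differ.\<close>

section \<open>Weak convergence in Lebesgue spaces\<close>

text \<open>The obstacle is that \<open>h \<phi>\<close> is only of class H^1: there the Riesz
  projection is unbounded, and bounded means with pointwise convergence do not give weak
  convergence. Hence every Cauchy integral below is that of a product of two Hardy functions with
  conjugate exponents, and a limit is taken in one factor while the other is a fixed test function.
  The exponent k - 1 comes from the weights: \<open>h\<close> carries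
  \<open>1 / (\<xi> + \<i>)\<close>, its counterpart made from the inverse of the minus factor
  carries \<open>1 / (\<xi> - \<i>)\<close>, and their quotient is one factor r. This unit accounts
  for the spurious degree -k that integrability removes. The identity
  \<open>r - 1 = - 2 * \<i> / (\<xi> + \<i>)\<close> explains why the point 1 decides everything: a
  zero of Q at 1 is exactly one extra factor \<open>1 / (\<xi> + \<i>)\<close>, which is enough
  decay to pass from H_q to H_p. In the second case of the theorem this condition is imposed once
  more, on the polynomial that survives integrability, and this costs one dimension.\<close>

lemma conjugate_exponent_gt_1:
  fixes p q :: real
  assumes "1 < p" "1 / p + 1 / q = 1"
  shows "1 < q"
proof -
  have "1 / q = 1 - 1 / p" "1 / p < 1" "0 < 1 / p"
    using assms by (auto simp: field_simps)
  then have "0 < 1 / q" "1 / q < 1"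
    by linarith+
  then show ?thesis
    by (simp add: field_simps)
qed

lemma mult_le_powr_add_powr:
  fixes p q a b :: real
  assumes "1 < p" "1 / p + 1 / q = 1" "0 \<le> a" "0 \<le> b"
  shows "a * b \<le> a powr p + b powr q"
proof -
  have q: "1 < q"
    by (rule conjugate_exponent_gt_1[OF assms(1,2)])
  have "a * b \<le> a powr p / p + b powr q / q"
    by (rule Youngs_inequality) (use assms q in auto)
  also have "\<dots> \<le> a powr p + b powr q"
    using assms(1) q by (intro add_mono) (auto simp: divide_le_eq mult_le_cancel_left1)
  finally show ?thesis .
qed

text \<open>Young's inequality for the rescaled pair \<open>d * a\<close> and \<open>b / d\<close>,
  where \<open>d powr p = e\<close>; the price of the small weight is the constant
  \<open>(1 / d) powr q\<close>.\<close>

lemma mult_le_eps_powr_add_powr: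
  fixes p q e :: real
  assumes "1 < p" "1 / p + 1 / q = 1" "0 < e"
  obtains c where "0 \<le> c" "\<And>a b. 0 \<le> a \<Longrightarrow> 0 \<le> b \<Longrightarrow> a * b \<le> e * a powr p + c * b powr q"
proof
  define d where "d = e powr (1 / p)"
  have d: "0 < d" "d powr p = e"
    using assms by (auto simp: d_def powr_powr)
  show "0 \<le> (1 / d) powr q"
    by simp
  fix a b :: real
  assume ab: "0 \<le> a" "0 \<le> b"
  have "a * b = (d * a) * (1 / d * b)"
    using d by simp
  also have "\<dots> \<le> (d * a) powr p + (1 / d * b) powr q"
    using assms d ab by (intro mult_le_powr_add_powr) auto
  also have "\<dots> = e * a powr p + (1 / d) powr q * b powr q"
    unfolding d(2)[symmetric] using d ab by (simp only: powr_mult)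
  finally show "a * b \<le> e * a powr p + (1 / d) powr q * b powr q" .
qed

lemma norm_diff_powr_le:
  fixes u v :: complex
  assumes "0 \<le> p"
  shows "norm (u - v) powr p \<le> 2 powr p * (norm u powr p + norm v powr p)"
proof -
  have "norm (u - v) \<le> 2 * max (norm u) (norm v)"
    using norm_triangle_ineq4[of u v] by linarith
  then have "norm (u - v) powr p \<le> (2 * max (norm u) (norm v)) powr p"
    using assms by (intro powr_mono2) auto
  also have "\<dots> = 2 powr p * max (norm u) (norm v) powr p"
    by (simp add: powr_mult le_max_iff_disj)
  also have "max (norm u) (norm v) powr p \<le> norm u powr p + norm v powr p"
    by (simp add: max_def)
  finally show ?thesis
    by simp
qed

lemma integrable_mult_powr:
  fixes f g :: "real \<Rightarrow> complex"
  assumes "1 < p" "1 / p + 1 / q = 1"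
    and "f \<in> borel_measurable lborel" "(\<integral>\<^sup>+x. ennreal (norm (f x) powr p) \<partial>lborel) < \<infinity>"
    and "g \<in> borel_measurable lborel" "(\<integral>\<^sup>+x. ennreal (norm (g x) powr q) \<partial>lborel) < \<infinity>"
  shows "integrable lborel (\<lambda>x. f x * g x)"
proof (rule Bochner_Integration.integrable_bound)
  show "integrable lborel (\<lambda>x. norm (f x) powr p + norm (g x) powr q)"
    using assms by (intro Bochner_Integration.integrable_add integrableI_bounded) auto
  show "AE x in lborel. norm (f x * g x) \<le> norm (norm (f x) powr p + norm (g x) powr q)"
    using mult_le_powr_add_powr[OF assms(1,2)] by (intro always_eventually) (simp add: norm_mult)
qed (use assms in measurable)

text \<open>Young's inequality with a small weight on the \<open>p\<close>-th power makes the remainder dominated,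
  so boundedness in \<open>L\<^sup>p\<close> and pointwise convergence are enough.\<close>

lemma weak_convergence_powr:
  fixes F :: "nat \<Rightarrow> real \<Rightarrow> complex" and f g :: "real \<Rightarrow> complex"
  assumes pq: "1 < p" "1 / p + 1 / q = 1"
    and F: "\<And>n. F n \<in> borel_measurable lborel"
      "\<And>n. (\<integral>\<^sup>+x. ennreal (norm (F n x) powr p) \<partial>lborel) \<le> ennreal C"
    and lim: "AE x in lborel. (\<lambda>n. F n x) \<longlonglongrightarrow> f x"
    and f: "f \<in> borel_measurable lborel" "(\<integral>\<^sup>+x. ennreal (norm (f x) powr p) \<partial>lborel) < \<infinity>"
    and g: "g \<in> borel_measurable lborel" "(\<integral>\<^sup>+x. ennreal (norm (g x) powr q) \<partial>lborel) < \<infinity>"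
  shows "(\<lambda>n. \<integral>x. F n x * g x \<partial>lborel) \<longlonglongrightarrow> (\<integral>x. f x * g x \<partial>lborel)"
proof -
  note [measurable] = F(1) f(1) g(1)
  have Fp: "integrable lborel (\<lambda>x. norm (F n x) powr p)" for n
    using F(2)[of n] by (intro integrableI_bounded) (auto simp: less_top[symmetric] top_unique)
  have fp: "integrable lborel (\<lambda>x. norm (f x) powr p)"
    using f(2) by (intro integrableI_bounded) auto
  have gq: "integrable lborel (\<lambda>x. norm (g x) powr q)"
    using g(2) by (intro integrableI_bounded) auto
  have F_int: "(\<integral>x. norm (F n x) powr p \<partial>lborel) \<le> max C 0" for n
    using F(2)[of n] Fp[of n]
    by (subst (asm) nn_integral_eq_integral) (auto simp: ennreal_le_iff2)
  \<comment> \<open>\<open>D\<close> bounds the p-th power integrals of \<open>F n - f\<close>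
    uniformly in n. It contains \<open>max C 0\<close> because the sign of \<open>C\<close> is free
    and \<open>ennreal C\<close> is 0 for negative \<open>C\<close>.\<close>
  define D where "D = 2 powr p * (max C 0 + (\<integral>x. norm (f x) powr p \<partial>lborel))"
  have D0: "0 \<le> D"
    by (simp add: D_def)
  have dp: "integrable lborel (\<lambda>x. norm (F n x - f x) powr p)"
    and D: "(\<integral>x. norm (F n x - f x) powr p \<partial>lborel) \<le> D" for n
  proof -
    have i: "integrable lborel (\<lambda>x. 2 powr p * (norm (F n x) powr p + norm (f x) powr p))"
      using Fp fp by simp
    show dp: "integrable lborel (\<lambda>x. norm (F n x - f x) powr p)"
      using pq by (intro Bochner_Integration.integrable_bound[OF i]) (auto intro!: always_eventually norm_diff_powr_le)
    have "(\<integral>x. norm (F n x - f x) powr p \<partial>lborel)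
        \<le> (\<integral>x. 2 powr p * (norm (F n x) powr p + norm (f x) powr p) \<partial>lborel)"
      using pq by (intro integral_mono dp i norm_diff_powr_le) auto
    also have "\<dots> \<le> D"
      using Fp fp F_int[of n] by (simp add: D_def)
    finally show "(\<integral>x. norm (F n x - f x) powr p \<partial>lborel) \<le> D" .
  qed
  have int: "integrable lborel (\<lambda>x. F n x * g x)" "integrable lborel (\<lambda>x. f x * g x)" for n
  proof -
    have "(\<integral>\<^sup>+x. ennreal (norm (F n x) powr p) \<partial>lborel) < \<infinity>"
      using F(2)[of n] by (auto simp: less_top[symmetric] top_unique)
    then show "integrable lborel (\<lambda>x. F n x * g x)" "integrable lborel (\<lambda>x. f x * g x)"
      using pq f g by (auto intro!: integrable_mult_powr)
  qed
  have intd: "integrable lborel (\<lambda>x. norm (F n x - f x) * norm (g x))" for n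
    using Bochner_Integration.integrable_diff[OF int(1)[of n] int(2), THEN integrable_norm]
    by (simp add: norm_mult flip: left_diff_distrib)
  have main: "(\<lambda>n. \<integral>x. norm (F n x - f x) * norm (g x) \<partial>lborel) \<longlonglongrightarrow> 0"
  proof (rule LIMSEQ_I)
    fix r :: real
    assume r: "0 < r"
    \<comment> \<open>Chosen so that \<open>e * D < r / 2\<close>; the summand 1 covers
      \<open>D = 0\<close>.\<close>
    define e where "e = r / (2 * (D + 1))"
    have e: "0 < e" "e * D < r / 2"
      using r D0 by (auto simp: e_def field_simps add_nonneg_pos)
    obtain c where c: "0 \<le> c"
      "\<And>a b. 0 \<le> a \<Longrightarrow> 0 \<le> b \<Longrightarrow> a * b \<le> e * a powr p + c * b powr q"
      using mult_le_eps_powr_add_powr[OF pq e(1)] by metis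
    \<comment> \<open>\<open>X n\<close> is the part of the integrand that exceeds
      \<open>e * norm (F n x - f x) powr p\<close>. Young's inequality dominates it by
      \<open>c * norm (g x) powr q\<close> for all n, so dominated convergence applies to it; the
      part cut off costs at most \<open>e * D\<close>.\<close>
    define X where "X n x = max 0 (norm (F n x - f x) * norm (g x) - e * norm (F n x - f x) powr p)" for n x
    have [measurable]: "X n \<in> borel_measurable lborel" for n
      unfolding X_def by measurable
    have X_le: "norm (X n x) \<le> c * norm (g x) powr q" for n x
      using c(2)[of "norm (F n x - f x)" "norm (g x)"] c(1) by (auto simp: X_def)
    have cg: "integrable lborel (\<lambda>x. c * norm (g x) powr q)"
      using gq by simp
    have X_int: "integrable lborel (X n)" for n
      by (intro Bochner_Integration.integrable_bound[OF cg] always_eventually) (use X_le c in auto)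
    have "(\<lambda>n. integral\<^sup>L lborel (X n)) \<longlonglongrightarrow> integral\<^sup>L lborel (\<lambda>x::real. 0)"
    proof (rule integral_dominated_convergence[where w = "\<lambda>x. c * norm (g x) powr q"])
      show "AE x in lborel. (\<lambda>n. X n x) \<longlonglongrightarrow> 0"
        using lim
      proof eventually_elim
        case (elim x)
        have d: "(\<lambda>n. norm (F n x - f x)) \<longlonglongrightarrow> 0"
          using elim by (simp add: LIM_zero_iff tendsto_norm_zero_iff)
        have "(\<lambda>n. norm (F n x - f x) powr p) \<longlonglongrightarrow> 0 powr p"
          using pq by (intro tendsto_powr'[OF d] tendsto_const) auto
        then have "(\<lambda>n. X n x) \<longlonglongrightarrow> max 0 (0 * norm (g x) - e * 0)"
          unfolding X_def using d by (intro tendsto_intros) auto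
        then show ?case
          by simp
      qed
    qed (use X_le cg in auto)
    then have "\<forall>\<^sub>F n in sequentially. integral\<^sup>L lborel (X n) < r / 2"
      using r by (intro order_tendstoD) auto
    then obtain N where N: "\<And>n. n \<ge> N \<Longrightarrow> integral\<^sup>L lborel (X n) < r / 2"
      by (auto simp: eventually_sequentially)
    have "norm ((\<integral>x. norm (F n x - f x) * norm (g x) \<partial>lborel) - 0) < r" if "n \<ge> N" for n
    proof -
      have "(\<integral>x. norm (F n x - f x) * norm (g x) \<partial>lborel)
          \<le> (\<integral>x. X n x + e * norm (F n x - f x) powr p \<partial>lborel)"
        
      proof (intro integral_mono intd)
        show "integrable lborel (\<lambda>x. X n x + e * norm (F n x - f x) powr p)"
          using dp[of n] X_int[of n] by simp
      qed (auto simp: X_def)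
      also have "\<dots> = integral\<^sup>L lborel (X n) + e * (\<integral>x. norm (F n x - f x) powr p \<partial>lborel)"
        using dp[of n] X_int[of n] by simp
      also have "\<dots> \<le> integral\<^sup>L lborel (X n) + e * D"
        using D e(1) by (intro add_left_mono mult_left_mono) auto
      also have "\<dots> < r"
        using N[OF that] e(2) by simp
      finally show ?thesis
        by (simp add: integral_nonneg_AE)
    qed
    then show "\<exists>N. \<forall>n\<ge>N. norm ((\<integral>x. norm (F n x - f x) * norm (g x) \<partial>lborel) - 0) < r"
      by blast
  qed
  have "(\<lambda>n. (\<integral>x. F n x * g x \<partial>lborel) - (\<integral>x. f x * g x \<partial>lborel)) \<longlonglongrightarrow> 0"
  proof (rule Lim_null_comparison[OF always_eventually main], rule allI)
    fix n
    have "(\<integral>x. F n x * g x \<partial>lborel) - (\<integral>x. f x * g x \<partial>lborel)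
        = (\<integral>x. (F n x - f x) * g x \<partial>lborel)"
      using int(1)[of n] int(2) by (simp add: left_diff_distrib)
    also have "norm \<dots> \<le> (\<integral>x. norm ((F n x - f x) * g x) \<partial>lborel)"
      by simp
    finally show "norm ((\<integral>x. F n x * g x \<partial>lborel) - (\<integral>x. f x * g x \<partial>lborel))
        \<le> (\<integral>x. norm (F n x - f x) * norm (g x) \<partial>lborel)"
      by (simp add: norm_mult)
  qed
  then show ?thesis
    by (simp add: LIM_zero_iff)
qed

section \<open>Cauchy integrals along the real line\<close>

lemma contour_integral_linepath_same_Im:
  assumes "a < b"
  shows "contour_integral (linepath (Complex a y) (Complex b y)) f = integral {a..b} (\<lambda>x. f (Complex x y))"
proof -
  have "contour_integral (linepath (Complex a y) (Complex b y)) f =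
      (Complex b y - Complex a y) * integral {0..1} (\<lambda>x. f (linepath (Complex a y) (Complex b y) x))"
    by (simp add: contour_integral_integral)
  also have "Complex b y - Complex a y = of_real (b - a)"
    by (simp add: complex_eq_iff)
  also have "integral {0..1} (\<lambda>x. f (linepath (Complex a y) (Complex b y) x)) =
      integral {0..(b - a) / (b - a)} (\<lambda>x. f (Complex (a + (b - a) * x) y))"
    using assms by (simp add: linepath_def complex_eq_iff Complex_eq algebra_simps scaleR_conv_of_real)
  also have "{0..(b - a) / (b - a)} = (\<lambda>x. x / (b - a)) ` {0..b - a}"
    using assms by simp
  also have "integral \<dots> (\<lambda>x. f (Complex (a + (b - a) * x) y)) =
      integral {a - a..b - a} (\<lambda>x. f (Complex (x + a) y)) / of_real (b - a)"
    using assms by (subst integral_stretch_real) (auto simp: scaleR_conv_of_real add_ac)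
  also have "\<dots> = integral {a..b} (\<lambda>x. f (Complex x y)) / of_real (b - a)"
    by (subst integral_shift_real_ivl) (rule refl)
  finally show ?thesis
    using assms by simp
qed

text \<open>Stated in \<open>ennreal\<close>, so that the bound enters Tonelli's theorem directly.
  In the application \<open>k\<close> bounds the Cauchy kernel on one side of a rectangle and
  \<open>h\<close> is the remaining factor.\<close>

lemma ennreal_norm_integral_le:
  fixes f :: "real \<Rightarrow> complex"
  assumes cont: "continuous_on {a..b} f" and k: "0 \<le> k"
    and h: "h \<in> borel_measurable lborel" "\<And>x. x \<in> {a..b} \<Longrightarrow> norm (f x) \<le> k * norm (h x)"
  shows "ennreal (norm (integral {a..b} f))
    \<le> ennreal k * (\<integral>\<^sup>+x. ennreal (norm (h x)) * indicator {a..b} x \<partial>lborel)"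
proof -
  have si: "set_integrable lborel {a..b} f"
    using borel_integrable_atLeastAtMost'[OF cont] .
  have "ennreal (norm (integral {a..b} f)) = ennreal (norm (LINT x:{a..b}|lborel. f x))"
    using set_borel_integral_eq_integral[OF si] by simp
  also have "\<dots> \<le> (\<integral>\<^sup>+x. ennreal (norm (indicator {a..b} x *\<^sub>R f x)) \<partial>lborel)"
    unfolding set_lebesgue_integral_def
    by (rule integral_norm_bound_ennreal) (use si in \<open>simp add: set_integrable_def\<close>)
  also have "\<dots> \<le> (\<integral>\<^sup>+x. ennreal k * (ennreal (norm (h x)) * indicator {a..b} x) \<partial>lborel)"
  proof (rule nn_integral_mono)
    fix x
    show "ennreal (norm (indicator {a..b} x *\<^sub>R f x)) \<le> ennreal k * (ennreal (norm (h x)) * indicator {a..b} x)"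
      using h(2)[of x] k by (auto simp: indicator_def ennreal_mult[symmetric] intro!: ennreal_leI)
  qed
  also have "\<dots> = ennreal k * (\<integral>\<^sup>+x. ennreal (norm (h x)) * indicator {a..b} x \<partial>lborel)"
    by (rule nn_integral_cmult) (use h(1) in measurable)
  finally show ?thesis .
qed

lemma continuous_on_Complex [continuous_intros]:
  fixes f g :: "'a::topological_space \<Rightarrow> real"
  assumes "continuous_on S f" "continuous_on S g"
  shows "continuous_on S (\<lambda>x. Complex (f x) (g x))"
  unfolding Complex_eq by (intro continuous_intros assms)

lemma borel_measurable_lborel_continuous:
  fixes f :: "'a::euclidean_space \<Rightarrow> 'b::topological_space"
  assumes "continuous_on UNIV f"
  shows "f \<in> borel_measurable lborel"
  using borel_measurable_continuous_onI[OF assms] by simp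

text \<open>As \<open>G\<close> need not decay pointwise, the vertical sides of the rectangles are controlled only on average over their abscissa.\<close>

lemma cauchy_integral_real_line:
  fixes G :: "complex \<Rightarrow> complex"
  assumes cont: "continuous_on {w. 0 \<le> Im w} G"
    and bound: "\<And>y. 0 \<le> y \<Longrightarrow> (\<integral>\<^sup>+x. ennreal (norm (G (Complex x y))) \<partial>lborel) \<le> ennreal C"
    and z: "Im z \<noteq> 0"
    and contour: "\<And>R. R > norm z \<Longrightarrow>
      ((\<lambda>w. G w / (w - z)) has_contour_integral c) (rectpath (Complex (- R) 0) (Complex R R))"
  shows "integral\<^sup>L lborel (\<lambda>t. G (of_real t) / (of_real t - z)) = c"
proof -
  have C0: "(\<integral>\<^sup>+x. ennreal (norm (G (Complex x y))) \<partial>lborel) < \<infinity>" if "0 \<le> y" for y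
    using bound[OF that] by (auto simp: less_top[symmetric] top_unique)
  have mes [measurable]: "(\<lambda>x. G (Complex x y)) \<in> borel_measurable lborel" if "0 \<le> y" for y
    using that by (intro borel_measurable_lborel_continuous
        continuous_on_compose2[OF cont] continuous_intros) auto
  have quot: "norm (G w / (w - z)) \<le> (1 / d) * norm (G w)" if "0 < d" "d \<le> norm (w - z)" for w d
    using that by (auto simp: norm_divide intro!: divide_left_mono mult_pos_pos)
  let ?h = "\<lambda>t. G (of_real t) / (of_real t - z)"
  have ofr: "of_real t = Complex t 0" for t
    by (simp add: complex_of_real_def)
  have hm: "?h \<in> borel_measurable lborel"
    using mes[of 0] unfolding ofr[symmetric] by measurable
  have hi: "integrable lborel ?h"
  proof (rule Bochner_Integration.integrable_bound)
    show "integrable lborel (\<lambda>t. 1 / \<bar>Im z\<bar> * norm (G (Complex t 0)))"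
      using C0[of 0] by (intro integrable_mult_right integrable_norm integrableI_bounded) auto
    show "AE t in lborel. norm (?h t) \<le> norm (1 / \<bar>Im z\<bar> * norm (G (Complex t 0)))"
    proof (intro always_eventually allI)
      fix t
      have "\<bar>Im z\<bar> \<le> norm (of_real t - z)"
        using abs_Im_le_cmod[of "of_real t - z"] by simp
      then show "norm (?h t) \<le> norm (1 / \<bar>Im z\<bar> * norm (G (Complex t 0)))"
        using quot[of "\<bar>Im z\<bar>" "of_real t"] z by (simp add: ofr[symmetric])
    qed
  qed (fact hm)
  define A where "A R = (LINT t:{-R..R}|lborel. ?h t)" for R
  have A_lim: "(A \<longlongrightarrow> integral\<^sup>L lborel ?h) at_top"
    unfolding A_def set_lebesgue_integral_def
  proof (rule integral_dominated_convergence_at_top[where w = "\<lambda>t. norm (?h t)"])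
    show "\<forall>\<^sub>F R in at_top. AE t in lborel. norm (indicator {-R..R} t *\<^sub>R ?h t) \<le> norm (?h t)"
      by (intro always_eventually allI) (auto simp: indicator_def)
    show "AE t in lborel. ((\<lambda>R. indicator {-R..R} t *\<^sub>R ?h t) \<longlongrightarrow> ?h t) at_top"
    proof (rule always_eventually, rule allI, rule tendsto_eventually)
      fix t
      show "\<forall>\<^sub>F R in at_top. indicator {-R..R} t *\<^sub>R ?h t = ?h t"
        using eventually_ge_at_top[of "\<bar>t\<bar>"] by eventually_elim (auto simp: indicator_def)
    qed
  qed (use hi hm in auto)
  \<comment> \<open>The mass of \<open>G\<close> on the two vertical sides of the rectangle with
    half-width and height \<open>R\<close>.\<close>
  define W where "W R = (\<integral>\<^sup>+t. (ennreal (norm (G (Complex R t))) + ennreal (norm (G (Complex (-R) t))))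
      * indicator {0..R} t \<partial>lborel)" for R
  \<comment> \<open>On the three sides off the real line the modulus is at least \<open>R\<close>,
    so the kernel is at most \<open>1 / (R - norm z)\<close>. The top side contributes at most
    \<open>C\<close> by hypothesis, the vertical ones \<open>W R\<close>.\<close>
  have estimate: "ennreal (norm (c - A R)) \<le> ennreal (1 / (R - norm z)) * (W R + ennreal C)"
    if R: "norm z < R" for R
  proof -
    let ?f = "\<lambda>w. G w / (w - z)"
    have R0: "0 < R"
      using R norm_ge_zero[of z] by linarith
    let ?a = "Complex (-R) 0" and ?b = "Complex R 0" and ?c = "Complex R R" and ?d = "Complex (-R) R"
    have zn: "\<bar>Re z\<bar> < R" "\<bar>Im z\<bar> < R"
      using R abs_Re_le_cmod[of z] abs_Im_le_cmod[of z] by linarith+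
    have fc: "continuous_on S ?f" if "S \<subseteq> {w. 0 \<le> Im w}" "z \<notin> S" for S
      using that by (intro continuous_intros continuous_on_subset[OF cont]) auto
    have seg: "closed_segment ?a ?b \<subseteq> {w. 0 \<le> Im w}" "z \<notin> closed_segment ?a ?b"
      "closed_segment ?b ?c \<subseteq> {w. 0 \<le> Im w}" "z \<notin> closed_segment ?b ?c"
      "closed_segment ?c ?d \<subseteq> {w. 0 \<le> Im w}" "z \<notin> closed_segment ?c ?d"
      "closed_segment ?d ?a \<subseteq> {w. 0 \<le> Im w}" "z \<notin> closed_segment ?d ?a"
      using zn z R0 by (auto simp: closed_segment_same_Im closed_segment_same_Re closed_segment_eq_real_ivl)
    have ci: "?f contour_integrable_on linepath ?a ?b" "?f contour_integrable_on linepath ?b ?c"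
      "?f contour_integrable_on linepath ?c ?d" "?f contour_integrable_on linepath ?d ?a"
      by (intro contour_integrable_continuous_linepath fc seg)+
    have "c = contour_integral (rectpath ?a ?c) ?f"
      using contour[OF R] by (simp add: contour_integral_unique)
    also have "\<dots> = contour_integral (linepath ?a ?b) ?f + (contour_integral (linepath ?b ?c) ?f
        + (contour_integral (linepath ?c ?d) ?f + contour_integral (linepath ?d ?a) ?f))"
      using ci by (simp add: rectpath_def Let_def contour_integrable_joinI)
    also have "contour_integral (linepath ?c ?d) ?f = - contour_integral (linepath ?d ?c) ?f"
      using contour_integral_reversepath[of "linepath ?d ?c" ?f] by simp
    also have "contour_integral (linepath ?d ?a) ?f = - contour_integral (linepath ?a ?d) ?f"
      using contour_integral_reversepath[of "linepath ?a ?d" ?f] by simp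
    also have "contour_integral (linepath ?a ?b) ?f = integral {-R..R} (\<lambda>x. ?f (Complex x 0))"
      using R0 by (intro contour_integral_linepath_same_Im) auto
    also have "contour_integral (linepath ?d ?c) ?f = integral {-R..R} (\<lambda>x. ?f (Complex x R))"
      using R0 by (intro contour_integral_linepath_same_Im) auto
    also have "contour_integral (linepath ?b ?c) ?f = \<i> * integral {0..R} (\<lambda>x. ?f (Complex R x))"
      using R0 by (intro contour_integral_linepath_same_Re) auto
    also have "contour_integral (linepath ?a ?d) ?f = \<i> * integral {0..R} (\<lambda>x. ?f (Complex (-R) x))"
      using R0 by (intro contour_integral_linepath_same_Re) auto
    also have "integral {-R..R} (\<lambda>x. ?f (Complex x 0)) = A R"
      unfolding A_def ofr
    proof (rule set_borel_integral_eq_integral(2)[symmetric])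
      show "set_integrable lborel {- R..R} (\<lambda>t. G (Complex t 0) / (Complex t 0 - z))"
        using hi unfolding set_integrable_def ofr
        by (intro integrable_mult_indicator) auto
    qed
    finally have eq: "c - A R = (\<i> * integral {0..R} (\<lambda>x. ?f (Complex R x))
        - \<i> * integral {0..R} (\<lambda>x. ?f (Complex (-R) x))) - integral {-R..R} (\<lambda>x. ?f (Complex x R))"
      by simp
    let ?k = "1 / (R - norm z)"
    have k: "0 \<le> ?k"
      using R by simp
    have cR: "continuous_on {0..R} (\<lambda>x. G (Complex s x))" for s
      by (intro continuous_on_compose2[OF cont] continuous_intros) auto
    \<comment> \<open>Clamping the height extends \<open>G\<close> from the vertical side to a
      function that is continuous on the whole line, as global measurability requires.\<close>
    define gv where "gv s x = G (Complex s (max 0 x))" for s x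
    have [measurable]: "gv s \<in> borel_measurable lborel" for s
      unfolding gv_def
      by (intro borel_measurable_lborel_continuous
        continuous_on_compose2[OF cont] continuous_intros) auto
    have gv: "gv s x = G (Complex s x)" if "x \<in> {0..R}" for s x
      using that by (simp add: gv_def max_def)
    have dist: "R - norm z \<le> norm (w - z)" if "R \<le> norm w" for w
      using that norm_triangle_ineq2[of w z] by linarith
    have b1: "ennreal (norm (integral {0..R} (\<lambda>x. ?f (Complex s x))))
        \<le> ennreal ?k * (\<integral>\<^sup>+x. ennreal (norm (gv s x)) * indicator {0..R} x \<partial>lborel)" if s: "\<bar>s\<bar> = R" for s
    proof (rule ennreal_norm_integral_le)
      show "continuous_on {0..R} (\<lambda>x. ?f (Complex s x))"
        using zn s by (intro continuous_intros cR) (auto simp: complex_eq_iff)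
      show "norm (?f (Complex s x)) \<le> ?k * norm (gv s x)" if "x \<in> {0..R}" for x
      proof -
        have "R \<le> norm (Complex s x)"
          using abs_Re_le_cmod[of "Complex s x"] s by simp
        then show ?thesis
          using quot[of "R - norm z" "Complex s x"] dist R by (simp add: gv[OF that])
      qed
    qed (use k in auto)
    have b2: "ennreal (norm (integral {-R..R} (\<lambda>x. ?f (Complex x R))))
        \<le> ennreal ?k * (\<integral>\<^sup>+x. ennreal (norm (G (Complex x R))) * indicator {-R..R} x \<partial>lborel)"
    proof (rule ennreal_norm_integral_le)
      show "continuous_on {-R..R} (\<lambda>x. ?f (Complex x R))"
        using zn R0 by (intro continuous_intros continuous_on_compose2[OF cont]) (auto simp: complex_eq_iff)
      show "norm (?f (Complex x R)) \<le> ?k * norm (G (Complex x R))" if "x \<in> {-R..R}" for x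
      proof -
        have "R \<le> norm (Complex x R)"
          using abs_Im_le_cmod[of "Complex x R"] R0 by simp
        then show ?thesis
          using quot[of "R - norm z" "Complex x R"] dist R by simp
      qed
    qed (use k R0 in auto)
    have "ennreal (norm (c - A R)) \<le> ennreal (norm (integral {0..R} (\<lambda>x. ?f (Complex R x)))
        + norm (integral {0..R} (\<lambda>x. ?f (Complex (-R) x))) + norm (integral {-R..R} (\<lambda>x. ?f (Complex x R))))"
      unfolding eq
      by (intro ennreal_leI order_trans[OF norm_triangle_ineq4] add_mono) (auto simp: norm_mult)
    also have "\<dots> = ennreal (norm (integral {0..R} (\<lambda>x. ?f (Complex R x))))
        + ennreal (norm (integral {0..R} (\<lambda>x. ?f (Complex (-R) x)))) + ennreal (norm (integral {-R..R} (\<lambda>x. ?f (Complex x R))))"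
      by simp
    also have "\<dots> \<le> ennreal ?k * (\<integral>\<^sup>+x. ennreal (norm (gv R x)) * indicator {0..R} x \<partial>lborel)
        + ennreal ?k * (\<integral>\<^sup>+x. ennreal (norm (gv (-R) x)) * indicator {0..R} x \<partial>lborel)
        + ennreal ?k * (\<integral>\<^sup>+x. ennreal (norm (G (Complex x R))) * indicator {-R..R} x \<partial>lborel)"
      using R0 by (intro add_mono b1 b2) auto
    also have "\<dots> = ennreal ?k * (W R + (\<integral>\<^sup>+x. ennreal (norm (G (Complex x R))) * indicator {-R..R} x \<partial>lborel))"
    proof -
      have "W R = (\<integral>\<^sup>+x. ennreal (norm (gv R x)) * indicator {0..R} x + ennreal (norm (gv (-R) x)) * indicator {0..R} x \<partial>lborel)"
        unfolding W_def by (intro nn_integral_cong) (auto simp: indicator_def gv)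
      also have "\<dots> = (\<integral>\<^sup>+x. ennreal (norm (gv R x)) * indicator {0..R} x \<partial>lborel)
        + (\<integral>\<^sup>+x. ennreal (norm (gv (-R) x)) * indicator {0..R} x \<partial>lborel)"
        by (intro nn_integral_add) auto
      finally show ?thesis
        by (simp add: distrib_left)
    qed
    also have "\<dots> \<le> ennreal ?k * (W R + ennreal C)"
    proof (intro mult_left_mono add_left_mono)
      have "(\<integral>\<^sup>+x. ennreal (norm (G (Complex x R))) * indicator {-R..R} x \<partial>lborel)
          \<le> (\<integral>\<^sup>+x. ennreal (norm (G (Complex x R))) \<partial>lborel)"
        by (intro nn_integral_mono) (auto simp: indicator_def)
      then show "(\<integral>\<^sup>+x. ennreal (norm (G (Complex x R))) * indicator {-R..R} x \<partial>lborel) \<le> ennreal C"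
        using bound[of R] R0 by simp
    qed auto
    finally show ?thesis .
  qed
  \<comment> \<open>Tonelli turns vertical mass into horizontal mass: for abscissae in
    \<open>{R..2*R}\<close> the heights stay below \<open>2 * R\<close>, and at each height the two
    abscissae s and -s together give at most \<open>2 * max C 0\<close>. Thus \<open>W\<close> has
    average at most \<open>4 * max C 0\<close> on this interval.\<close>
  have avg: "(\<integral>\<^sup>+s. W s * indicator {R..2*R} s \<partial>lborel) \<le> ennreal (4 * R * max C 0)" if R: "0 < R" for R
  proof -
    define H where "H s t = ennreal (norm (G (Complex s (max 0 t)))) + ennreal (norm (G (Complex (-s) (max 0 t))))" for s t
    have [measurable]: "(\<lambda>x. G (Complex (fst x) (max 0 (snd x)))) \<in> borel_measurable (lborel \<Otimes>\<^sub>M lborel)"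
      "(\<lambda>x. G (Complex (- fst x) (max 0 (snd x)))) \<in> borel_measurable (lborel \<Otimes>\<^sub>M lborel)"
      unfolding lborel_prod by (intro borel_measurable_lborel_continuous
        continuous_on_compose2[OF cont] continuous_intros; auto)+
    have [measurable]: "(\<lambda>x. G (Complex s (max 0 x))) \<in> borel_measurable lborel" for s
      by (intro borel_measurable_lborel_continuous
        continuous_on_compose2[OF cont] continuous_intros) auto
    have [measurable]: "(\<lambda>x. G (Complex (-x) y)) \<in> borel_measurable lborel" if "0 \<le> y" for y
      using that by (intro borel_measurable_lborel_continuous
        continuous_on_compose2[OF cont] continuous_intros) auto
    have Hm [measurable]: "(\<lambda>(s, t). H s t * indicator {0..2*R} t) \<in> borel_measurable (lborel \<Otimes>\<^sub>M lborel)"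
      unfolding H_def split_def by measurable
    have "(\<integral>\<^sup>+s. W s * indicator {R..2*R} s \<partial>lborel) \<le> (\<integral>\<^sup>+s. (\<integral>\<^sup>+t. H s t * indicator {0..2*R} t \<partial>lborel) \<partial>lborel)"
    proof (rule nn_integral_mono)
      fix s
      have "W s \<le> (\<integral>\<^sup>+t. H s t * indicator {0..2*R} t \<partial>lborel)" if "s \<in> {R..2*R}"
        unfolding W_def H_def
        by (intro nn_integral_mono) (use that in \<open>auto simp: indicator_def max_def\<close>)
      then show "W s * indicator {R..2*R} s \<le> (\<integral>\<^sup>+t. H s t * indicator {0..2*R} t \<partial>lborel)"
        by (auto simp: indicator_def)
    qed
    also have "\<dots> = (\<integral>\<^sup>+t. (\<integral>\<^sup>+s. H s t * indicator {0..2*R} t \<partial>lborel) \<partial>lborel)"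
      by (rule lborel_pair.Fubini'[symmetric]) (fact Hm)
    also have "\<dots> \<le> (\<integral>\<^sup>+t. ennreal (2 * max C 0) * indicator {0..2*R} t \<partial>lborel)"
    proof (rule nn_integral_mono)
      fix t
      have "(\<integral>\<^sup>+s. H s t \<partial>lborel) \<le> ennreal (2 * max C 0)" if t: "0 \<le> t"
      proof -
        have "(\<integral>\<^sup>+s. H s t \<partial>lborel) = (\<integral>\<^sup>+s. ennreal (norm (G (Complex s t))) \<partial>lborel)
            + (\<integral>\<^sup>+s. ennreal (norm (G (Complex (-s) t))) \<partial>lborel)"
          unfolding H_def using t by (subst nn_integral_add) auto
        also have "(\<integral>\<^sup>+s. ennreal (norm (G (Complex (-s) t))) \<partial>lborel) = (\<integral>\<^sup>+s. ennreal (norm (G (Complex s t))) \<partial>lborel)"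
          using nn_integral_real_affine[of "\<lambda>s. ennreal (norm (G (Complex s t)))" "-1" 0] t by simp
        also have "(\<integral>\<^sup>+s. ennreal (norm (G (Complex s t))) \<partial>lborel) + (\<integral>\<^sup>+s. ennreal (norm (G (Complex s t))) \<partial>lborel)
            \<le> ennreal (max C 0) + ennreal (max C 0)"
          by (intro add_mono order_trans[OF bound[OF t]] ennreal_leI) auto
        finally show ?thesis
          by (simp flip: ennreal_plus)
      qed
      then show "(\<integral>\<^sup>+s. H s t * indicator {0..2*R} t \<partial>lborel) \<le> ennreal (2 * max C 0) * indicator {0..2*R} t"
        by (auto simp: indicator_def)
    qed
    also have "\<dots> = ennreal (2 * max C 0) * ennreal (2 * R)"
      using R by (subst nn_integral_cmult_indicator) auto
    also have "\<dots> = ennreal (4 * R * max C 0)"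
      using R by (subst ennreal_mult[symmetric]) (auto simp: algebra_simps)
    finally show ?thesis .
  qed
  show ?thesis
  proof (rule ccontr)
    assume neq: "integral\<^sup>L lborel ?h \<noteq> c"
    define e where "e = norm (integral\<^sup>L lborel ?h - c) / 2"
    have e: "0 < e"
      using neq by (simp add: e_def)
    have "((\<lambda>R. norm (c - A R)) \<longlongrightarrow> norm (c - integral\<^sup>L lborel ?h)) at_top"
      by (intro tendsto_intros A_lim)
    moreover have "e < norm (c - integral\<^sup>L lborel ?h)"
      using e by (simp add: e_def norm_minus_commute)
    ultimately have "\<forall>\<^sub>F R in at_top. e < norm (c - A R)"
      by (rule order_tendstoD)
    then obtain R0 where R0: "\<And>R. R \<ge> R0 \<Longrightarrow> e < norm (c - A R)"
      by (auto simp: eventually_at_top_linorder)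
    \<comment> \<open>The thresholds serve in turn: \<open>e < norm (c - A R)\<close>; distance
      \<open>s - norm z\<close> at least \<open>R / 2\<close>;
      \<open>max C 0 \<le> e * R / 4\<close>; and the final contradiction, where 16 is the quotient
      of the 4 in \<open>avg\<close> and the 1/4 in \<open>low\<close>.\<close>
    define R where "R = max R0 (max (2 * norm z + 1) (max (4 * max C 0 / e) (16 * max C 0 / e + 1)))"
    have R: "R0 \<le> R" "2 * norm z + 1 \<le> R" "4 * max C 0 / e \<le> R" "16 * max C 0 / e + 1 \<le> R"
      unfolding R_def by (simp_all only: le_max_iff_disj order_refl simp_thms)
    have Rpos: "0 < R"
      using R(2) norm_ge_zero[of z] by linarith
    \<comment> \<open>If the formula failed, every abscissa beyond \<open>R\<close> would carry mass
      growing linearly in \<open>R\<close>, against the average of \<open>W\<close>, which stays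
      bounded.\<close>
    have low: "ennreal (e * R / 4) \<le> W s" if s: "R \<le> s" for s
    proof (cases "W s = \<infinity>")
      case False
      then obtain w where w: "W s = ennreal w" "0 \<le> w"
        by (cases "W s") auto
      have sz: "norm z < s"
        using R(2) s norm_ge_zero[of z] by linarith
      have "ennreal e \<le> ennreal (norm (c - A s))"
        using R0[of s] R(1) s by (intro ennreal_leI) auto
      also have "\<dots> \<le> ennreal (1 / (s - norm z)) * (W s + ennreal C)"
        by (rule estimate[OF sz])
      also have "\<dots> \<le> ennreal (1 / (s - norm z)) * (W s + ennreal (max C 0))"
        by (intro mult_left_mono add_left_mono ennreal_leI) auto
      also have "\<dots> = ennreal (1 / (s - norm z) * (w + max C 0))"
        using w sz by (simp add: ennreal_mult[symmetric] del: ennreal_plus flip: ennreal_plus)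
      finally have "e \<le> 1 / (s - norm z) * (w + max C 0)"
        using w sz by (subst (asm) ennreal_le_iff) auto
      then have "e * (s - norm z) \<le> w + max C 0"
        using sz by (simp add: field_simps)
      moreover have "e * (R / 2) \<le> e * (s - norm z)"
        using R(2) s e by (intro mult_left_mono) auto
      moreover have "max C 0 \<le> e * R / 4"
        using R(3) e by (simp add: field_simps)
      ultimately have "e * R / 4 \<le> w"
        by (simp add: field_simps)
      then show ?thesis
        by (simp add: w)
    qed auto
    have "ennreal (e * R / 4) * ennreal R = (\<integral>\<^sup>+s. ennreal (e * R / 4) * indicator {R..2*R} s \<partial>lborel)"
      using Rpos by (subst nn_integral_cmult_indicator) auto
    also have "\<dots> \<le> (\<integral>\<^sup>+s. W s * indicator {R..2*R} s \<partial>lborel)"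
      by (intro nn_integral_mono) (auto simp: indicator_def low)
    also have "\<dots> \<le> ennreal (4 * R * max C 0)"
      by (rule avg[OF Rpos])
    finally have "e * R / 4 * R \<le> 4 * R * max C 0"
      using e Rpos by (subst (asm) ennreal_mult[symmetric]) (auto simp: ennreal_le_iff)
    then have "e * R \<le> 16 * max C 0"
      using Rpos by (simp add: field_simps)
    moreover have "16 * max C 0 + e \<le> e * R"
      using R(4) e by (simp add: field_simps)
    ultimately show False
      using e by linarith
  qed
qed

section \<open>Boundary values of Hardy functions\<close>

text \<open>Membership in \<open>hardy_plus\<close> at the level of representatives, with the
  holomorphic extension kept as an explicit partner, since the Cauchy formula and uniqueness speak
  about both.\<close>

definition hardy_bv :: "real \<Rightarrow> (real \<Rightarrow> complex) \<Rightarrow> (complex \<Rightarrow> complex) \<Rightarrow> bool" where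
  "hardy_bv p f F \<longleftrightarrow>
     f \<in> borel_measurable lborel \<and> (\<integral>\<^sup>+x. ennreal (norm (f x) powr p) \<partial>lborel) < \<infinity> \<and>
     hardy_fun p F \<and> (AE x in lborel. nontangential_limit F x (f x))"

lemma hardy_fun_holomorphic: "hardy_fun p F \<Longrightarrow> F holomorphic_on {z. 0 < Im z}"
  by (simp add: hardy_fun_def)

lemma hardy_fun_bound:
  assumes "hardy_fun p F"
  obtains C where "0 \<le> C"
    "\<And>y. 0 < y \<Longrightarrow> (\<integral>\<^sup>+x. ennreal (norm (F (Complex x y)) powr p) \<partial>lborel) \<le> ennreal C"
proof -
  let ?S = "SUP y\<in>{0<..}. \<integral>\<^sup>+x. ennreal (norm (F (Complex x y)) powr p) \<partial>lborel"
  have "?S < \<infinity>"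
    using assms by (simp add: hardy_fun_def)
  then obtain C where C: "0 \<le> C" "?S = ennreal C"
    by (cases ?S) auto
  moreover have "(\<integral>\<^sup>+x. ennreal (norm (F (Complex x y)) powr p) \<partial>lborel) \<le> ?S" if "0 < y" for y
    using that by (intro SUP_upper) auto
  ultimately show ?thesis
    using that by auto
qed

lemma hardy_funI:
  assumes "F holomorphic_on {z. 0 < Im z}" "C < \<infinity>"
    and "\<And>y. 0 < y \<Longrightarrow> (\<integral>\<^sup>+x. ennreal (norm (F (Complex x y)) powr p) \<partial>lborel) \<le> C"
  shows "hardy_fun p F"
proof -
  have "(SUP y\<in>{0<..}. \<integral>\<^sup>+x. ennreal (norm (F (Complex x y)) powr p) \<partial>lborel) \<le> C"
    using assms(3) by (intro SUP_least) auto
  then show ?thesis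
    using assms(1,2) by (simp add: hardy_fun_def le_less_trans)
qed

lemma holomorphic_line_measurable:
  assumes "F holomorphic_on {z. 0 < Im z}" "0 < y"
  shows "(\<lambda>x. F (Complex x y)) \<in> borel_measurable lborel"
  using assms by (intro borel_measurable_lborel_continuous
      continuous_on_compose2[OF holomorphic_on_imp_continuous_on[OF assms(1)]] continuous_intros) auto

lemma nontangential_limit_vertical:
  assumes "nontangential_limit F x l" "\<And>n. 0 < y n" "y \<longlonglongrightarrow> 0"
  shows "(\<lambda>n. F (Complex x (y n))) \<longlonglongrightarrow> l"
proof -
  \<comment> \<open>Aperture 1 is an arbitrary choice: the vertical ray lies in every cone.\<close>
  have F: "(F \<longlongrightarrow> l) (at (complex_of_real x) within {z. Im z > 0 \<and> \<bar>Re z - x\<bar> < 1 * Im z})"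
    using assms(1) unfolding nontangential_limit_def by (rule allE[of _ 1]) simp
  have "(\<lambda>n. Complex x (y n)) \<longlonglongrightarrow> Complex x 0"
    by (intro tendsto_Complex tendsto_const assms(3))
  then have "filterlim (\<lambda>n. Complex x (y n)) (at (complex_of_real x) within {z. Im z > 0 \<and> \<bar>Re z - x\<bar> < 1 * Im z}) sequentially"
    unfolding filterlim_at using assms(2)
    by (auto simp: complex_of_real_def intro!: always_eventually) (metis less_irrefl)
  then show ?thesis
    by (rule filterlim_compose[OF F])
qed

lemma nontangential_limit_unique:
  assumes "nontangential_limit F x l" "nontangential_limit F x l'"
  shows "l = l'"
proof -
  have "(\<lambda>n. F (Complex x (inverse (real (Suc n))))) \<longlonglongrightarrow> l"
    "(\<lambda>n. F (Complex x (inverse (real (Suc n))))) \<longlonglongrightarrow> l'"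
    using assms by (auto intro!: nontangential_limit_vertical LIMSEQ_inverse_real_of_nat simp del: of_nat_Suc)
  then show ?thesis
    by (rule LIMSEQ_unique)
qed

lemma nontangential_limit_mult:
  assumes "nontangential_limit F x l" "nontangential_limit G x m"
  shows "nontangential_limit (\<lambda>z. F z * G z) x (l * m)"
  using assms unfolding nontangential_limit_def by (auto intro!: tendsto_mult)

lemma nontangential_limit_isCont:
  assumes "isCont M (complex_of_real x)"
  shows "nontangential_limit M x (M (complex_of_real x))"
  using assms unfolding nontangential_limit_def isCont_def
  by (auto intro: tendsto_within_subset)

lemma nontangential_limit_cong:
  assumes "\<And>z. 0 < Im z \<Longrightarrow> F z = G z" "nontangential_limit F x l"
  shows "nontangential_limit G x l"
  unfolding nontangential_limit_def
proof (intro allI impI)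
  fix a :: real
  assume "0 < a"
  then have "(F \<longlongrightarrow> l) (at (complex_of_real x) within {z. 0 < Im z \<and> \<bar>Re z - x\<bar> < a * Im z})"
    using assms(2) by (simp add: nontangential_limit_def)
  then show "(G \<longlongrightarrow> l) (at (complex_of_real x) within {z. 0 < Im z \<and> \<bar>Re z - x\<bar> < a * Im z})"
    by (rule Lim_transform_within[OF _ zero_less_one]) (simp add: assms(1))
qed

lemma powr_integral_mult_bounded:
  fixes f m :: "real \<Rightarrow> complex"
  assumes "0 \<le> p" "f \<in> borel_measurable lborel" "\<And>x. norm (m x) \<le> K"
  shows "(\<integral>\<^sup>+x. ennreal (norm (f x * m x) powr p) \<partial>lborel)
    \<le> ennreal (K powr p) * (\<integral>\<^sup>+x. ennreal (norm (f x) powr p) \<partial>lborel)"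
proof -
  have K: "0 \<le> K"
    using assms(3)[of 0] norm_ge_zero[of "m 0"] by linarith
  have "norm (f x * m x) powr p \<le> K powr p * norm (f x) powr p" for x
  proof -
    have "norm (f x * m x) powr p \<le> (norm (f x) * K) powr p"
      using assms(1,3) by (intro powr_mono2) (auto simp: norm_mult intro: mult_left_mono)
    also have "\<dots> = K powr p * norm (f x) powr p"
      using K by (simp add: powr_mult mult.commute)
    finally show ?thesis .
  qed
  then have "(\<integral>\<^sup>+x. ennreal (norm (f x * m x) powr p) \<partial>lborel)
      \<le> (\<integral>\<^sup>+x. ennreal (K powr p) * ennreal (norm (f x) powr p) \<partial>lborel)"
    by (intro nn_integral_mono) (simp add: ennreal_mult[symmetric] ennreal_leI)
  also have "\<dots> = ennreal (K powr p) * (\<integral>\<^sup>+x. ennreal (norm (f x) powr p) \<partial>lborel)"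
    by (rule nn_integral_cmult) (use assms in measurable)
  finally show ?thesis .
qed

text \<open>For positive shifts the product is holomorphic across the real line, and Young's
  inequality bounds its means on all higher lines by \<open>C1 + C2\<close>, which is what
  \<open>cauchy_integral_real_line\<close> asks for. The shifts are independent because they will
  tend to 0 separately.\<close>

lemma cauchy_integral_shift:
  assumes pq: "1 < p" "1 / p + 1 / q = 1"
    and F1: "hardy_fun p F1" and F2: "hardy_fun q F2"
    and ab: "0 < a" "0 < b" and z: "Im z \<noteq> 0"
  shows "(\<integral>t. F1 (Complex t a) * F2 (Complex t b) / (of_real t - z) \<partial>lborel) =
    (if 0 < Im z then 2 * of_real pi * \<i> * (F1 (z + \<i> * of_real a) * F2 (z + \<i> * of_real b)) else 0)"
    (is "_ = ?c")
proof -
  obtain C1 where C1: "0 \<le> C1"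
    "\<And>y. 0 < y \<Longrightarrow> (\<integral>\<^sup>+x. ennreal (norm (F1 (Complex x y)) powr p) \<partial>lborel) \<le> ennreal C1"
    using hardy_fun_bound[OF F1] by metis
  obtain C2 where C2: "0 \<le> C2"
    "\<And>y. 0 < y \<Longrightarrow> (\<integral>\<^sup>+x. ennreal (norm (F2 (Complex x y)) powr q) \<partial>lborel) \<le> ennreal C2"
    using hardy_fun_bound[OF F2] by metis
  note h1 = hardy_fun_holomorphic[OF F1] and h2 = hardy_fun_holomorphic[OF F2]
  define G where "G w = F1 (w + \<i> * of_real a) * F2 (w + \<i> * of_real b)" for w
  \<comment> \<open>The half-plane \<open>{w. d < Im w}\<close> is convex, contains the closed upper
    half-plane, and lies in the domain of both translates.\<close>
  define d where "d = - min a b"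
  have d: "d < 0" "d \<ge> - a" "d \<ge> - b"
    using ab by (auto simp: d_def)
  have G: "G holomorphic_on {w. d < Im w}"
  proof -
    have "(\<lambda>w. F1 (w + \<i> * of_real a)) holomorphic_on {w. d < Im w}"
      using d by (intro holomorphic_on_compose_gen[OF _ h1, unfolded o_def] holomorphic_intros) auto
    moreover have "(\<lambda>w. F2 (w + \<i> * of_real b)) holomorphic_on {w. d < Im w}"
      using d by (intro holomorphic_on_compose_gen[OF _ h2, unfolded o_def] holomorphic_intros) auto
    ultimately show ?thesis
      unfolding G_def by (rule holomorphic_on_mult)
  qed
  have Gline: "G (Complex x y) = F1 (Complex x (y + a)) * F2 (Complex x (y + b))" for x y
    by (simp add: G_def Complex_eq algebra_simps)
  have "integral\<^sup>L lborel (\<lambda>t. G (of_real t) / (of_real t - z)) = ?c"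
  proof (rule cauchy_integral_real_line[OF _ _ z])
    show "continuous_on {w. 0 \<le> Im w} G"
      using d by (intro holomorphic_on_imp_continuous_on holomorphic_on_subset[OF G]) auto
    show "(\<integral>\<^sup>+x. ennreal (norm (G (Complex x y))) \<partial>lborel) \<le> ennreal (C1 + C2)" if y: "0 \<le> y" for y
    proof -
      have [measurable]: "(\<lambda>x. F1 (Complex x (y + a))) \<in> borel_measurable lborel"
        "(\<lambda>x. F2 (Complex x (y + b))) \<in> borel_measurable lborel"
        using y ab holomorphic_line_measurable[OF h1] holomorphic_line_measurable[OF h2] by auto
      have "(\<integral>\<^sup>+x. ennreal (norm (G (Complex x y))) \<partial>lborel)
          \<le> (\<integral>\<^sup>+x. ennreal (norm (F1 (Complex x (y + a))) powr p) + ennreal (norm (F2 (Complex x (y + b))) powr q) \<partial>lborel)"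
        unfolding Gline norm_mult
        by (intro nn_integral_mono) (simp add: ennreal_leI mult_le_powr_add_powr[OF pq] flip: ennreal_plus)
      also have "\<dots> = (\<integral>\<^sup>+x. ennreal (norm (F1 (Complex x (y + a))) powr p) \<partial>lborel)
          + (\<integral>\<^sup>+x. ennreal (norm (F2 (Complex x (y + b))) powr q) \<partial>lborel)"
        by (rule nn_integral_add) measurable
      also have "\<dots> \<le> ennreal C1 + ennreal C2"
        using y ab by (intro add_mono C1(2) C2(2)) auto
      finally show ?thesis
        using C1(1) C2(1) by simp
    qed
    fix R assume R: "norm z < R"
    have zn: "\<bar>Re z\<bar> < R" "\<bar>Im z\<bar> < R"
      using R abs_Re_le_cmod[of z] abs_Im_le_cmod[of z] by linarith+
    let ?\<gamma> = "rectpath (Complex (- R) 0) (Complex R R)"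
    have im: "path_image ?\<gamma> = {w. Re w \<in> {-R, R} \<and> Im w \<in> {0..R}} \<union> {w. Im w \<in> {0, R} \<and> Re w \<in> {-R..R}}"
      using zn by (subst path_image_rectpath) auto
    show "((\<lambda>w. G w / (w - z)) has_contour_integral ?c) ?\<gamma>"
    proof (cases "0 < Im z")
      case True
      have "((\<lambda>w. G w / (w - z)) has_contour_integral 2 * pi * \<i> * winding_number ?\<gamma> z * G z) ?\<gamma>"
      proof (rule Cauchy_integral_formula_convex_simple[OF _ G])
        show "convex {w. d < Im w}"
          by (rule convex_halfspace_Im_gt)
        show "z \<in> interior {w. d < Im w}"
          using True d by (subst interior_open) (auto simp: open_halfspace_Im_gt)
        show "path_image ?\<gamma> \<subseteq> {w. d < Im w} - {z}"
          unfolding im using zn True d by auto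
      qed auto
      moreover have "winding_number ?\<gamma> z = 1"
        using zn True by (intro winding_number_rectpath) (auto simp: in_box_complex_iff)
      ultimately show ?thesis
        using True by (simp add: G_def)
    next
      case False
      then have neg: "Im z < 0"
        using z by simp
      have "((\<lambda>w. G w / (w - z)) has_contour_integral 0) ?\<gamma>"
      proof (rule Cauchy_theorem_convex_simple)
        \<comment> \<open>The half-plane now starts no lower than \<open>Im z\<close>, which
          excludes the pole, and still contains the rectangle because \<open>d\<close> and
          \<open>Im z\<close> are negative.\<close>
        show "convex {w. max d (Im z) < Im w}"
          by (rule convex_halfspace_Im_gt)
        show "(\<lambda>w. G w / (w - z)) holomorphic_on {w. max d (Im z) < Im w}"
          by (intro holomorphic_intros holomorphic_on_subset[OF G]) auto
        show "path_image ?\<gamma> \<subseteq> {w. max d (Im z) < Im w}"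
          unfolding im using zn neg d by auto
      qed auto
      then show ?thesis
        using False by simp
    qed
  qed
  moreover have "G (of_real t) = F1 (Complex t a) * F2 (Complex t b)" for t
    using Gline[of t 0] by (simp add: complex_of_real_def)
  ultimately show ?thesis
    by simp
qed

text \<open>Letting the two shifts tend to \<open>0\<close> one after the other uses only weak convergence of one factor
  at a time, although the product is merely of class \<open>H\<^sup>1\<close>.\<close>

theorem cauchy_integral_product:
  assumes pq: "1 < p" "1 / p + 1 / q = 1"
    and f1: "hardy_bv p f1 F1" and f2: "hardy_bv q f2 F2" and z: "Im z \<noteq> 0"
  shows "(\<integral>t. f1 t * f2 t / (of_real t - z) \<partial>lborel) =
    (if 0 < Im z then 2 * of_real pi * \<i> * (F1 z * F2 z) else 0)"
proof -
  have qp: "1 < q" "1 / q + 1 / p = 1"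
    using conjugate_exponent_gt_1[OF pq] pq(2) by simp_all
  define y where "y n = inverse (real (Suc n))" for n
  have y: "y n > 0" "y \<longlonglongrightarrow> 0" for n
    unfolding y_def using LIMSEQ_inverse_real_of_nat by auto
  from f1 have F1: "hardy_fun p F1" and f1m [measurable]: "f1 \<in> borel_measurable lborel"
    and f1p: "(\<integral>\<^sup>+x. ennreal (norm (f1 x) powr p) \<partial>lborel) < \<infinity>"
    and l1: "AE x in lborel. nontangential_limit F1 x (f1 x)"
    by (auto simp: hardy_bv_def)
  from f2 have F2: "hardy_fun q F2" and f2m [measurable]: "f2 \<in> borel_measurable lborel"
    and f2p: "(\<integral>\<^sup>+x. ennreal (norm (f2 x) powr q) \<partial>lborel) < \<infinity>"
    and l2: "AE x in lborel. nontangential_limit F2 x (f2 x)"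
    by (auto simp: hardy_bv_def)
  note h1 = hardy_fun_holomorphic[OF F1] and h2 = hardy_fun_holomorphic[OF F2]
  obtain C1 where C1:
    "\<And>y. 0 < y \<Longrightarrow> (\<integral>\<^sup>+x. ennreal (norm (F1 (Complex x y)) powr p) \<partial>lborel) \<le> ennreal C1"
    using hardy_fun_bound[OF F1] by metis
  obtain C2 where C2:
    "\<And>y. 0 < y \<Longrightarrow> (\<integral>\<^sup>+x. ennreal (norm (F2 (Complex x y)) powr q) \<partial>lborel) \<le> ennreal C2"
    using hardy_fun_bound[OF F2] by metis
  have [measurable]: "(\<lambda>t. 1 / (complex_of_real t - z)) \<in> borel_measurable lborel"
    by measurable
  have kernel: "norm (1 / (complex_of_real t - z)) \<le> 1 / \<bar>Im z\<bar>" for t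
  proof -
    have "\<bar>Im z\<bar> \<le> norm (complex_of_real t - z)"
      using abs_Im_le_cmod[of "of_real t - z"] by simp
    then show ?thesis
      using z by (simp add: norm_divide frac_le)
  qed
  have kernel_int: "(\<integral>\<^sup>+t. ennreal (norm (h t * (1 / (complex_of_real t - z))) powr s) \<partial>lborel) < \<infinity>"
    if "0 \<le> s" "h \<in> borel_measurable lborel" "(\<integral>\<^sup>+t. ennreal (norm (h t) powr s) \<partial>lborel) < \<infinity>" for h s
  proof (rule le_less_trans[OF powr_integral_mult_bounded[OF that(1,2) kernel]])
    show "ennreal ((1 / \<bar>Im z\<bar>) powr s) * (\<integral>\<^sup>+t. ennreal (norm (h t) powr s) \<partial>lborel) < \<infinity>"
      using that(3) by (simp add: ennreal_mult_less_top)
  qed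
  have lim: "(\<lambda>n. F (z + \<i> * of_real (y n))) \<longlonglongrightarrow> F z"
    if "F holomorphic_on {z. 0 < Im z}" "0 < Im z" for F
  proof -
    have "isCont F z"
      using holomorphic_on_imp_continuous_on[OF that(1)] that(2)
        continuous_on_eq_continuous_at[OF open_halfspace_Im_gt[of 0]] by blast
    moreover have "(\<lambda>n. z + \<i> * of_real (y n)) \<longlonglongrightarrow> z"
      using tendsto_add[OF tendsto_const[of z] tendsto_mult[OF tendsto_const[of \<i>] tendsto_of_real[OF y(2)]]]
      by simp
    ultimately show ?thesis
      by (rule isCont_tendsto_compose)
  qed
  \<comment> \<open>First limit: the shift of \<open>F1\<close> tends to 0 while \<open>F2\<close>
    on the line of height \<open>b\<close>, times the kernel, is the test function.\<close>
  have step: "(\<integral>t. f1 t * (F2 (Complex t b) * (1 / (of_real t - z))) \<partial>lborel) =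
      (if 0 < Im z then 2 * of_real pi * \<i> * (F1 z * F2 (z + \<i> * of_real b)) else 0)" if b: "0 < b" for b
  proof -
    have m2 [measurable]: "(\<lambda>t. F2 (Complex t b)) \<in> borel_measurable lborel"
      using b by (intro holomorphic_line_measurable h2)
    have "(\<lambda>n. \<integral>t. F1 (Complex t (y n)) * (F2 (Complex t b) * (1 / (of_real t - z))) \<partial>lborel)
        \<longlonglongrightarrow> (\<integral>t. f1 t * (F2 (Complex t b) * (1 / (of_real t - z))) \<partial>lborel)"
    proof (rule weak_convergence_powr[OF pq])
      show "(\<integral>\<^sup>+x. ennreal (norm (F1 (Complex x (y n))) powr p) \<partial>lborel) \<le> ennreal C1" for n
        by (intro C1 y)
      show "AE x in lborel. (\<lambda>n. F1 (Complex x (y n))) \<longlonglongrightarrow> f1 x"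
        using l1 by eventually_elim (intro nontangential_limit_vertical y)
      show "(\<integral>\<^sup>+x. ennreal (norm (F2 (Complex x b) * (1 / (of_real x - z))) powr q) \<partial>lborel) < \<infinity>"
        using C2[OF b] qp by (intro kernel_int m2) (auto simp: less_top[symmetric] top_unique)
      show "(\<lambda>t. F1 (Complex t (y n))) \<in> borel_measurable lborel" for n
        by (intro holomorphic_line_measurable h1 y)
    qed (use f1p in measurable)
    moreover have "(\<lambda>n. \<integral>t. F1 (Complex t (y n)) * (F2 (Complex t b) * (1 / (of_real t - z))) \<partial>lborel)
        \<longlonglongrightarrow> (if 0 < Im z then 2 * of_real pi * \<i> * (F1 z * F2 (z + \<i> * of_real b)) else 0)"
      using cauchy_integral_shift[OF pq F1 F2 y(1) b z] by (auto intro!: tendsto_intros lim[OF h1])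
    ultimately show ?thesis
      by (rule LIMSEQ_unique)
  qed
  \<comment> \<open>Second limit, with the exponents exchanged: the boundary function
    \<open>f1\<close> times the kernel is now the test function, and the translates of
    \<open>F2\<close> are the convergent family.\<close>
  have "(\<lambda>n. \<integral>t. F2 (Complex t (y n)) * (f1 t * (1 / (of_real t - z))) \<partial>lborel)
      \<longlonglongrightarrow> (\<integral>t. f2 t * (f1 t * (1 / (of_real t - z))) \<partial>lborel)"
  proof (rule weak_convergence_powr[OF qp])
    show "(\<integral>\<^sup>+x. ennreal (norm (F2 (Complex x (y n))) powr q) \<partial>lborel) \<le> ennreal C2" for n
      by (intro C2 y)
    show "AE x in lborel. (\<lambda>n. F2 (Complex x (y n))) \<longlonglongrightarrow> f2 x"
      using l2 by eventually_elim (intro nontangential_limit_vertical y)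
    show "(\<integral>\<^sup>+x. ennreal (norm (f1 x * (1 / (of_real x - z))) powr p) \<partial>lborel) < \<infinity>"
      using pq f1p by (intro kernel_int f1m) auto
    show "(\<lambda>t. F2 (Complex t (y n))) \<in> borel_measurable lborel" for n
      by (intro holomorphic_line_measurable h2 y)
  qed (use f2p in measurable)
  moreover have "(\<lambda>n. \<integral>t. F2 (Complex t (y n)) * (f1 t * (1 / (of_real t - z))) \<partial>lborel)
      \<longlonglongrightarrow> (if 0 < Im z then 2 * of_real pi * \<i> * (F1 z * F2 z) else 0)"
    unfolding mult.left_commute[of "F2 _"] step[OF y(1)]
    by (auto intro!: tendsto_intros lim[OF h2])
  ultimately have "(\<integral>t. f2 t * (f1 t * (1 / (of_real t - z))) \<partial>lborel) =
      (if 0 < Im z then 2 * of_real pi * \<i> * (F1 z * F2 z) else 0)"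
    by (rule LIMSEQ_unique)
  then show ?thesis
    by (simp add: mult_ac)
qed

section \<open>Multiplication by functions of the Cayley transform\<close>

text \<open>The extension of \<open>r_mf\<close> off the real line. It maps the closed upper
  half-plane into the closed unit disc and tends to 1 at infinity; its pole is
  \<open>- \<i>\<close>.\<close>

definition cayley :: "complex \<Rightarrow> complex" where
  "cayley z = (z - \<i>) / (z + \<i>)"

lemma plus_i_nonzero: "0 \<le> Im z \<Longrightarrow> z + \<i> \<noteq> 0"
  by (auto simp: complex_eq_iff)

lemma of_real_plus_i_nonzero [simp]: "complex_of_real x + \<i> \<noteq> 0"
  by (auto simp: complex_eq_iff)

lemma of_real_neq_i [simp]: "complex_of_real x \<noteq> \<i>"
  by (metis Im_complex_of_real imaginary_unit.sel(2) zero_neq_one)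

lemma cayley_of_real_nonzero [simp]: "cayley (complex_of_real x) \<noteq> 0"
  by (simp add: cayley_def)

lemma norm_cayley_le:
  assumes "0 \<le> Im z"
  shows "norm (cayley z) \<le> 1"
proof -
  have "norm (z - \<i>) \<le> norm (z + \<i>)"
    using assms unfolding cmod_def by (intro real_sqrt_le_mono) (auto simp: power2_eq_square algebra_simps)
  then show ?thesis
    using plus_i_nonzero[OF assms] by (simp add: cayley_def norm_divide)
qed

lemma cnj_cayley_of_real: "cnj (cayley (complex_of_real x)) = inverse (cayley (complex_of_real x))"
  by (simp add: cayley_def)

text \<open>The source of all constants \<open>- 2 * \<i>\<close> and \<open>\<i> / 2\<close> below:
  it trades a factor \<open>r - 1\<close> for a factor \<open>1 / (\<xi> + \<i>)\<close>.\<close>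

lemma cayley_minus_1: "0 \<le> Im z \<Longrightarrow> cayley z - 1 = - 2 * \<i> / (z + \<i>)"
  using plus_i_nonzero[of z] by (simp add: cayley_def field_simps)

lemma inj_cayley_of_real: "inj (\<lambda>x. cayley (complex_of_real x))"
proof (rule injI)
  fix x y assume "cayley (complex_of_real x) = cayley (complex_of_real y)"
  then have "(of_real x - \<i>) * (of_real y + \<i>) = (of_real y - \<i>) * (complex_of_real x + \<i>)"
    unfolding cayley_def by (simp add: frac_eq_eq)
  then show "x = y"
    by (auto simp: complex_eq_iff algebra_simps)
qed

lemma holomorphic_on_poly_cayley: "(\<lambda>z. poly Q (cayley z)) holomorphic_on {z. 0 \<le> Im z}"
  unfolding cayley_def by (intro holomorphic_intros) (auto simp: plus_i_nonzero)

lemma isCont_poly_cayley: "isCont (\<lambda>z. poly Q (cayley z)) (complex_of_real x)"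
  unfolding cayley_def by (intro continuous_intros) auto

lemma poly_cayley_bounded:
  obtains K where "\<And>z. 0 \<le> Im z \<Longrightarrow> norm (poly Q (cayley z)) \<le> K"
proof -
  have "compact (poly Q ` cball 0 1)"
    by (intro compact_continuous_image continuous_intros compact_cball)
  then obtain K where "\<And>w. w \<in> cball 0 1 \<Longrightarrow> norm (poly Q w) \<le> K"
    by (meson bounded_iff compact_imp_bounded imageI)
  then show ?thesis
    using that[of K] norm_cayley_le by simp
qed

lemma poly_cayley_lower_bound:
  assumes "poly Q 1 \<noteq> 0"
  obtains d M where "0 < d" "\<And>z. M \<le> norm z \<Longrightarrow> d \<le> norm (poly Q (cayley z))"
proof -
  have "((\<lambda>z. 2 * \<i> / (z + \<i>)) \<longlongrightarrow> 0) at_infinity"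
    by (intro tendsto_divide_0[OF tendsto_const] tendsto_add_filterlim_at_infinity'[OF _ tendsto_const] filterlim_ident)
  then have "((\<lambda>z. 1 - 2 * \<i> / (z + \<i>)) \<longlongrightarrow> 1 - 0) at_infinity"
    by (intro tendsto_intros)
  moreover have "\<forall>\<^sub>F z in at_infinity. 1 - 2 * \<i> / (z + \<i>) = cayley z"
    unfolding eventually_at_infinity
  \<comment> \<open>Modulus at least 2 keeps \<open>z\<close> away from the pole
    \<open>- \<i>\<close>.\<close>
  proof (intro exI[of _ 2] allI impI)
    fix z :: complex assume "2 \<le> norm z"
    then have "z + \<i> \<noteq> 0"
      by (auto simp: add_eq_0_iff2)
    then show "1 - 2 * \<i> / (z + \<i>) = cayley z"
      by (simp add: cayley_def field_simps)
  qed
  ultimately have "(cayley \<longlongrightarrow> 1) at_infinity"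
    by (simp cong: filterlim_cong add: filterlim_cong[OF refl refl])
  then have "((\<lambda>z. norm (poly Q (cayley z))) \<longlongrightarrow> norm (poly Q 1)) at_infinity"
    by (intro tendsto_norm isCont_tendsto_compose[OF poly_isCont])
  moreover have "norm (poly Q 1) / 2 < norm (poly Q 1)"
    using assms by simp
  ultimately have "\<forall>\<^sub>F z in at_infinity. norm (poly Q 1) / 2 < norm (poly Q (cayley z))"
    by (rule order_tendstoD)
  then obtain M where "\<And>z. M \<le> norm z \<Longrightarrow> norm (poly Q 1) / 2 < norm (poly Q (cayley z))"
    unfolding eventually_at_infinity by blast
  then show ?thesis
    using assms by (intro that[of "norm (poly Q 1) / 2" M]) (auto intro: less_imp_le)
qed

section \<open>Multipliers, inclusions and uniqueness for Hardy functions\<close>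

lemma hardy_bv_cong_AE:
  assumes "hardy_bv p f F" "AE x in lborel. f x = g x" "g \<in> borel_measurable lborel"
  shows "hardy_bv p g F"
proof -
  have "(\<integral>\<^sup>+x. ennreal (norm (g x) powr p) \<partial>lborel) = (\<integral>\<^sup>+x. ennreal (norm (f x) powr p) \<partial>lborel)"
    by (rule nn_integral_cong_AE) (use assms(2) in eventually_elim, simp)
  moreover have "AE x in lborel. nontangential_limit F x (g x)"
  proof -
    have "AE x in lborel. nontangential_limit F x (f x)"
      using assms(1) by (simp add: hardy_bv_def)
    then show ?thesis
      using assms(2) by eventually_elim simp
  qed
  ultimately show ?thesis
    using assms by (simp add: hardy_bv_def)
qed

text \<open>A bounded multiplier changes the means by at most \<open>K powr p\<close>. Continuity at
  real points is a separate assumption because holomorphy on the closed half-plane controls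
  \<open>M\<close> from above only.\<close>

lemma hardy_bv_mult:
  assumes p: "0 \<le> p" and f: "hardy_bv p f F"
    and M: "M holomorphic_on {z. 0 \<le> Im z}" "\<And>x. isCont M (complex_of_real x)"
      "\<And>z. 0 \<le> Im z \<Longrightarrow> norm (M z) \<le> K"
  shows "hardy_bv p (\<lambda>x. f x * M (of_real x)) (\<lambda>z. F z * M z)"
proof -
  from f have F: "hardy_fun p F" and fm [measurable]: "f \<in> borel_measurable lborel"
    and fp: "(\<integral>\<^sup>+x. ennreal (norm (f x) powr p) \<partial>lborel) < \<infinity>"
    and l: "AE x in lborel. nontangential_limit F x (f x)"
    by (auto simp: hardy_bv_def)
  have [measurable]: "(\<lambda>x. M (of_real x)) \<in> borel_measurable lborel"
    by (intro borel_measurable_lborel_continuous continuous_on_compose2[OF holomorphic_on_imp_continuous_on[OF M(1)]] continuous_intros) auto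
  note hol = hardy_fun_holomorphic[OF F]
  obtain C where C: "0 \<le> C"
    "\<And>y. 0 < y \<Longrightarrow> (\<integral>\<^sup>+x. ennreal (norm (F (Complex x y)) powr p) \<partial>lborel) \<le> ennreal C"
    using hardy_fun_bound[OF F] by metis
  have "hardy_fun p (\<lambda>z. F z * M z)"
  proof (rule hardy_funI)
    show "(\<lambda>z. F z * M z) holomorphic_on {z. 0 < Im z}"
      by (intro holomorphic_on_mult hol holomorphic_on_subset[OF M(1)]) auto
    show "(\<integral>\<^sup>+x. ennreal (norm (F (Complex x y) * M (Complex x y)) powr p) \<partial>lborel)
        \<le> ennreal (K powr p) * ennreal C" if y: "0 < y" for y
      using y M(3) by (intro order_trans[OF powr_integral_mult_bounded[OF p holomorphic_line_measurable[OF hol y]]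
          mult_left_mono[OF C(2)[OF y]]]) auto
  qed (simp add: ennreal_mult_less_top)
  moreover have "(\<integral>\<^sup>+x. ennreal (norm (f x * M (of_real x)) powr p) \<partial>lborel) < \<infinity>"
  proof (rule le_less_trans[OF powr_integral_mult_bounded[OF p fm]])
    show "norm (M (complex_of_real x)) \<le> K" for x
      by (rule M(3)) simp
    show "ennreal (K powr p) * (\<integral>\<^sup>+x. ennreal (norm (f x) powr p) \<partial>lborel) < \<infinity>"
      using fp by (simp add: ennreal_mult_less_top)
  qed
  moreover have "AE x in lborel. nontangential_limit (\<lambda>z. F z * M z) x (f x * M (of_real x))"
    using l by eventually_elim (intro nontangential_limit_mult nontangential_limit_isCont M)
  moreover have "(\<lambda>x. f x * M (of_real x)) \<in> borel_measurable lborel"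
    by measurable
  ultimately show ?thesis
    by (simp add: hardy_bv_def)
qed

lemma hardy_bv_mult_poly_cayley:
  assumes "0 \<le> p" "hardy_bv p f F"
  shows "hardy_bv p (\<lambda>x. f x * poly Q (cayley (of_real x))) (\<lambda>z. F z * poly Q (cayley z))"
proof -
  obtain K where "\<And>z. 0 \<le> Im z \<Longrightarrow> norm (poly Q (cayley z)) \<le> K"
    using poly_cayley_bounded by metis
  then show ?thesis
    by (intro hardy_bv_mult[OF assms] holomorphic_on_poly_cayley isCont_poly_cayley)
qed

text \<open>\<open>1 / max 1 \<bar>x\<bar>\<close> majorises the modulus of
  \<open>1 / (z + \<i>)\<close> on all lines of nonnegative height at once, so this one integral
  bounds the supremum over heights.\<close>

lemma max_powr_integral_finite:
  assumes "1 < p"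
  shows "(\<integral>\<^sup>+x. ennreal ((1 / max 1 \<bar>x\<bar>) powr p) \<partial>lborel) < \<infinity>"
proof -
  let ?g = "\<lambda>x::real. ennreal (x powr - p) * indicator {1..} x"
  have g: "(\<integral>\<^sup>+x. ?g x \<partial>lborel) < \<infinity>"
    using nn_integral_has_integral_lebesgue'[OF _ has_integral_powr_to_inf[of "-p" 1]] assms by simp
  have "(\<integral>\<^sup>+x. ?g (- x) \<partial>lborel) = (\<integral>\<^sup>+x. ?g x \<partial>lborel)"
    using nn_integral_real_affine[of ?g "-1" 0] by simp
  then have g': "(\<integral>\<^sup>+x. ?g (- x) \<partial>lborel) < \<infinity>"
    using g by simp
  have "(\<integral>\<^sup>+x. ennreal ((1 / max 1 \<bar>x\<bar>) powr p) \<partial>lborel)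
      \<le> (\<integral>\<^sup>+x. indicator {-1..1} x + (?g x + ?g (- x)) \<partial>lborel)"
    by (intro nn_integral_mono) (auto simp: indicator_def max_def powr_minus_divide powr_divide simp del: divide_minus_right)
  also have "\<dots> = (\<integral>\<^sup>+x. indicator {-1..1::real} x \<partial>lborel) + ((\<integral>\<^sup>+x. ?g x \<partial>lborel) + (\<integral>\<^sup>+x. ?g (- x) \<partial>lborel))"
    by (simp add: nn_integral_add)
  also have "\<dots> < \<infinity>"
    using g g' by simp
  finally show ?thesis .
qed

lemma norm_inverse_plus_i_le:
  assumes "0 \<le> y"
  shows "norm (1 / (Complex x y + \<i>)) \<le> 1 / max 1 \<bar>x\<bar>"
proof -
  have "max 1 \<bar>x\<bar> \<le> norm (Complex x y + \<i>)"
    using abs_Re_le_cmod[of "Complex x y + \<i>"] abs_Im_le_cmod[of "Complex x y + \<i>"] assms by simp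
  then show ?thesis
    by (simp add: norm_divide frac_le)
qed

lemma holomorphic_on_inverse_plus_i: "(\<lambda>z. 1 / (z + \<i>)) holomorphic_on {z. 0 \<le> Im z}"
  by (intro holomorphic_intros) (auto simp: plus_i_nonzero)

lemma isCont_inverse_plus_i: "isCont (\<lambda>z. 1 / (z + \<i>)) (complex_of_real x)"
  by (intro continuous_intros) auto

lemma hardy_bv_inverse_plus_i:
  assumes "1 < p"
  shows "hardy_bv p (\<lambda>x. 1 / (of_real x + \<i>)) (\<lambda>z. 1 / (z + \<i>))"
proof -
  let ?C = "\<integral>\<^sup>+x. ennreal ((1 / max 1 \<bar>x\<bar>) powr p) \<partial>lborel"
  have le: "(\<integral>\<^sup>+x. ennreal (norm (1 / (Complex x y + \<i>)) powr p) \<partial>lborel) \<le> ?C" if "0 \<le> y" for y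
    using that assms by (intro nn_integral_mono ennreal_leI powr_mono2 norm_inverse_plus_i_le) auto
  have C: "?C < \<infinity>"
    using max_powr_integral_finite[OF assms] .
  have "hardy_fun p (\<lambda>z. 1 / (z + \<i>))"
    by (intro hardy_funI[OF _ C] le holomorphic_on_subset[OF holomorphic_on_inverse_plus_i]) auto
  moreover have "(\<integral>\<^sup>+x. ennreal (norm (1 / (complex_of_real x + \<i>)) powr p) \<partial>lborel) < \<infinity>"
    using le_less_trans[OF le[of 0] C] by (simp add: complex_of_real_def)
  moreover have "(\<lambda>x. 1 / (complex_of_real x + \<i>)) \<in> borel_measurable lborel"
    by measurable
  moreover have "nontangential_limit (\<lambda>z. 1 / (z + \<i>)) x (1 / (complex_of_real x + \<i>))" for x
    by (rule nontangential_limit_isCont[OF isCont_inverse_plus_i])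
  ultimately show ?thesis
    by (simp add: hardy_bv_def)
qed

lemma powr_le_powr_plus_1:
  fixes a p q :: real
  assumes "0 \<le> a" "0 \<le> p" "p \<le> q"
  shows "a powr p \<le> a powr q + 1"
proof (cases "a \<le> 1")
  case True
  then have "a powr p \<le> 1 powr p"
    using assms by (intro powr_mono2) auto
  then show ?thesis
    by (simp add: add_increasing)
next
  case False
  then have "a powr p \<le> a powr q"
    using assms by (intro powr_mono) auto
  then show ?thesis
    by simp
qed

text \<open>Division by \<open>\<xi> + \<i>\<close> carries H_q into H_p. With the weight
  \<open>?k\<close>, which is integrable and at most 1, \<open>\<bar>h\<bar>^p * ?k \<le>
  (\<bar>h\<bar>^q + 1) * ?k \<le> \<bar>h\<bar>^q + ?k\<close>, in place of Hoelder's
  inequality.\<close>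

lemma hardy_bv_divide_plus_i:
  assumes p: "1 < p" "p \<le> q" and u: "hardy_bv q u U"
  shows "hardy_bv p (\<lambda>x. u x * (1 / (of_real x + \<i>))) (\<lambda>z. U z * (1 / (z + \<i>)))"
proof -
  let ?k = "\<lambda>x::real. (1 / max 1 \<bar>x\<bar>) powr p"
  let ?C = "\<integral>\<^sup>+x. ennreal (?k x) \<partial>lborel"
  have C: "?C < \<infinity>"
    using max_powr_integral_finite[OF p(1)] .
  from u have U: "hardy_fun q U" and um [measurable]: "u \<in> borel_measurable lborel"
    and uq: "(\<integral>\<^sup>+x. ennreal (norm (u x) powr q) \<partial>lborel) < \<infinity>"
    and l: "AE x in lborel. nontangential_limit U x (u x)"
    by (auto simp: hardy_bv_def)
  note hol = hardy_fun_holomorphic[OF U]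
  obtain D where D: "0 \<le> D"
    "\<And>y. 0 < y \<Longrightarrow> (\<integral>\<^sup>+x. ennreal (norm (U (Complex x y)) powr q) \<partial>lborel) \<le> ennreal D"
    using hardy_fun_bound[OF U] by metis
  have le: "(\<integral>\<^sup>+x. ennreal (norm (h x * (1 / (Complex x y + \<i>))) powr p) \<partial>lborel)
      \<le> (\<integral>\<^sup>+x. ennreal (norm (h x) powr q) \<partial>lborel) + ?C"
    if [measurable]: "h \<in> borel_measurable lborel" and y: "0 \<le> y" for h :: "real \<Rightarrow> complex" and y
  proof -
    have "norm (h x * (1 / (Complex x y + \<i>))) powr p \<le> norm (h x) powr q + ?k x" for x
    proof -
      have k: "0 \<le> ?k x" "?k x \<le> 1"
        using powr_mono2[of p "1 / max 1 \<bar>x\<bar>" 1] p by auto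
      have "norm (h x * (1 / (Complex x y + \<i>))) powr p \<le> (norm (h x) * (1 / max 1 \<bar>x\<bar>)) powr p"
        unfolding norm_mult using p y
        by (intro powr_mono2 mult_left_mono norm_inverse_plus_i_le) auto
      also have "\<dots> = norm (h x) powr p * ?k x"
        by (rule powr_mult)
      also have "\<dots> \<le> (norm (h x) powr q + 1) * ?k x"
        using p k by (intro mult_right_mono powr_le_powr_plus_1) auto
      also have "\<dots> \<le> norm (h x) powr q + ?k x"
        using mult_left_mono[OF k(2), of "norm (h x) powr q"] by (simp add: algebra_simps)
      finally show ?thesis .
    qed
    then have "(\<integral>\<^sup>+x. ennreal (norm (h x * (1 / (Complex x y + \<i>))) powr p) \<partial>lborel)
        \<le> (\<integral>\<^sup>+x. ennreal (norm (h x) powr q) + ennreal (?k x) \<partial>lborel)"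
      by (intro nn_integral_mono) (simp add: ennreal_leI flip: ennreal_plus)
    also have "\<dots> = (\<integral>\<^sup>+x. ennreal (norm (h x) powr q) \<partial>lborel) + ?C"
      by (rule nn_integral_add) measurable
    finally show ?thesis .
  qed
  have "hardy_fun p (\<lambda>z. U z * (1 / (z + \<i>)))"
  proof (rule hardy_funI)
    show "(\<lambda>z. U z * (1 / (z + \<i>))) holomorphic_on {z. 0 < Im z}"
      by (intro holomorphic_on_mult hol holomorphic_on_subset[OF holomorphic_on_inverse_plus_i]) auto
    show "(\<integral>\<^sup>+x. ennreal (norm (U (Complex x y) * (1 / (Complex x y + \<i>))) powr p) \<partial>lborel) \<le> ennreal D + ?C"
      if y: "0 < y" for y
      using y by (intro order_trans[OF le[OF holomorphic_line_measurable[OF hol y]] add_right_mono[OF D(2)]]) auto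
  qed (use C in simp)
  moreover have "(\<integral>\<^sup>+x. ennreal (norm (u x * (1 / (of_real x + \<i>))) powr p) \<partial>lborel) < \<infinity>"
    using le[OF um, of 0] uq C by (auto simp: complex_of_real_def intro: le_less_trans)
  moreover have "AE x in lborel. nontangential_limit (\<lambda>z. U z * (1 / (z + \<i>))) x (u x * (1 / (of_real x + \<i>)))"
    using l by eventually_elim (intro nontangential_limit_mult nontangential_limit_isCont isCont_inverse_plus_i)
  moreover have "(\<lambda>x. u x * (1 / (of_real x + \<i>))) \<in> borel_measurable lborel"
    by measurable
  ultimately show ?thesis
    by (simp add: hardy_bv_def)
qed

lemma conjugate_exponent:
  assumes "1 < (p::real)"
  obtains q where "1 < q" "1 / p + 1 / q = 1"
proof
  show "1 < p / (p - 1)"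
    using assms by simp
qed (use assms in \<open>auto simp: field_simps\<close>)

text \<open>The factor \<open>1 / (z + \<i>)\<close> lies in every conjugate Hardy class, which reduces uniqueness to the
  Cauchy formula for products.\<close>

lemma hardy_bv_unique:
  assumes p: "1 < p" and q: "1 < q" and f: "hardy_bv p f F" and g: "hardy_bv q g G"
    and eq: "AE x in lborel. f x = g x" and z: "0 < Im z"
  shows "F z = G z"
proof -
  obtain p' where p': "1 < p'" "1 / p + 1 / p' = 1"
    using conjugate_exponent[OF p] by metis
  obtain q' where q': "1 < q'" "1 / q + 1 / q' = 1"
    using conjugate_exponent[OF q] by metis
  have z0: "Im z \<noteq> 0"
    using z by simp
  have [measurable]: "f \<in> borel_measurable lborel" "g \<in> borel_measurable lborel"
    using f g by (auto simp: hardy_bv_def)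
  have "(\<integral>t. f t * (1 / (of_real t + \<i>)) / (of_real t - z) \<partial>lborel)
      = (\<integral>t. g t * (1 / (of_real t + \<i>)) / (of_real t - z) \<partial>lborel)"
    by (rule integral_cong_AE) (measurable, use eq in eventually_elim, simp)
  then show ?thesis
    using cauchy_integral_product[OF p p'(2) f hardy_bv_inverse_plus_i[OF p'(1)] z0]
      cauchy_integral_product[OF q q'(2) g hardy_bv_inverse_plus_i[OF q'(1)] z0] z plus_i_nonzero[of z]
    by simp
qed

text \<open>\<open>Q(r)\<close> is bounded away from \<open>0\<close> near infinity because \<open>r \<rightarrow> 1\<close> there, and elsewhere
  \<open>\<bar>U\<bar>\<^sup>p \<le> \<bar>U\<bar>\<^sup>q + 1\<close>; in particular no Smirnov-type theorem is needed.\<close>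

lemma hardy_bv_of_mult_poly_cayley:
  assumes p: "1 < p" "p \<le> q" and u: "hardy_bv q u U" and w: "hardy_bv p w W"
    and eq: "AE x in lborel. w x = u x * poly Q (cayley (of_real x))" and Q: "poly Q 1 \<noteq> 0"
  shows "hardy_bv p u U"
proof -
  have q: "1 < q" "0 \<le> q"
    using p by auto
  obtain d M where d: "0 < d" and M: "\<And>z. M \<le> norm z \<Longrightarrow> d \<le> norm (poly Q (cayley z))"
    using poly_cayley_lower_bound[OF Q] by metis
  \<comment> \<open>The identity is given almost everywhere on the line; uniqueness lifts it to the
    half-plane, where the means of \<open>U\<close> have to be bounded.\<close>
  have W_eq: "W z = U z * poly Q (cayley z)" if "0 < Im z" for z
    using hardy_bv_unique[OF p(1) q(1) w hardy_bv_mult_poly_cayley[OF q(2) u] eq that] .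
  from u have U: "hardy_fun q U" and um [measurable]: "u \<in> borel_measurable lborel"
    and uq: "(\<integral>\<^sup>+x. ennreal (norm (u x) powr q) \<partial>lborel) < \<infinity>"
    and l: "AE x in lborel. nontangential_limit U x (u x)"
    by (auto simp: hardy_bv_def)
  from w have W: "hardy_fun p W" and wm [measurable]: "w \<in> borel_measurable lborel"
    and wp: "(\<integral>\<^sup>+x. ennreal (norm (w x) powr p) \<partial>lborel) < \<infinity>"
    by (auto simp: hardy_bv_def)
  obtain D where D: "0 \<le> D"
    "\<And>y. 0 < y \<Longrightarrow> (\<integral>\<^sup>+x. ennreal (norm (U (Complex x y)) powr q) \<partial>lborel) \<le> ennreal D"
    using hardy_fun_bound[OF U] by metis
  obtain E where E: "0 \<le> E"
    "\<And>y. 0 < y \<Longrightarrow> (\<integral>\<^sup>+x. ennreal (norm (W (Complex x y)) powr p) \<partial>lborel) \<le> ennreal E"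
    using hardy_fun_bound[OF W] by metis
  let ?c = "(1 / d) powr p"
  let ?I = "\<integral>\<^sup>+x. indicator {-M..M} x \<partial>lborel"
  have I: "?I < \<infinity>"
    by (simp add: emeasure_lborel_Icc_eq)
  \<comment> \<open>\<open>h\<close> and \<open>v\<close> are the values along a single line, so the
    same estimate serves every height \<open>y > 0\<close> and also the boundary functions at
    \<open>y = 0\<close>.\<close>
  have le: "(\<integral>\<^sup>+x. ennreal (norm (h x) powr p) \<partial>lborel)
      \<le> ennreal ?c * (\<integral>\<^sup>+x. ennreal (norm (v x) powr p) \<partial>lborel)
        + ((\<integral>\<^sup>+x. ennreal (norm (h x) powr q) \<partial>lborel) + ?I)"
    if [measurable]: "h \<in> borel_measurable lborel" "v \<in> borel_measurable lborel"
      and v: "AE x in lborel. v x = h x * poly Q (cayley (Complex x y))" for h v :: "real \<Rightarrow> complex" and y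
  proof -
    have "(\<integral>\<^sup>+x. ennreal (norm (h x) powr p) \<partial>lborel)
        \<le> (\<integral>\<^sup>+x. ennreal ?c * ennreal (norm (v x) powr p) + (ennreal (norm (h x) powr q) + indicator {-M..M} x) \<partial>lborel)"
    proof (rule nn_integral_mono_AE, use v in eventually_elim)
      fix x assume v: "v x = h x * poly Q (cayley (Complex x y))"
      show "ennreal (norm (h x) powr p) \<le> ennreal ?c * ennreal (norm (v x) powr p)
          + (ennreal (norm (h x) powr q) + indicator {-M..M} x)"
      proof (cases "\<bar>x\<bar> \<le> M")
        case True
        have "ennreal (norm (h x) powr p) \<le> ennreal (norm (h x) powr q + 1)"
          using p by (intro ennreal_leI powr_le_powr_plus_1) auto
        also have "\<dots> = ennreal (norm (h x) powr q) + indicator {-M..M} x"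
          using True by (simp add: indicator_def abs_le_iff)
        finally show ?thesis
          by (simp add: add_increasing)
      next
        case False
        then have "d \<le> norm (poly Q (cayley (Complex x y)))"
          using abs_Re_le_cmod[of "Complex x y"] by (intro M) simp
        then have "norm (h x) * d \<le> norm (v x)"
          unfolding v norm_mult by (intro mult_left_mono) auto
        then have "norm (h x) powr p \<le> (1 / d * norm (v x)) powr p"
          using d p by (intro powr_mono2) (auto simp: field_simps)
        also have "\<dots> = ?c * norm (v x) powr p"
          by (rule powr_mult)
        finally have "ennreal (norm (h x) powr p) \<le> ennreal ?c * ennreal (norm (v x) powr p)"
          by (simp add: ennreal_leI flip: ennreal_mult)
        then show ?thesis
          by (rule order_trans) (simp add: add_increasing2)
      qed
    qed
    also have "\<dots> = ennreal ?c * (\<integral>\<^sup>+x. ennreal (norm (v x) powr p) \<partial>lborel)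
        + ((\<integral>\<^sup>+x. ennreal (norm (h x) powr q) \<partial>lborel) + ?I)"
      by (simp add: nn_integral_add nn_integral_cmult)
    finally show ?thesis .
  qed
  have "hardy_fun p U"
  proof (rule hardy_funI[OF hardy_fun_holomorphic[OF U]])
    show "(\<integral>\<^sup>+x. ennreal (norm (U (Complex x y)) powr p) \<partial>lborel)
        \<le> ennreal ?c * ennreal E + (ennreal D + ?I)" if y: "0 < y" for y
    proof (rule order_trans[OF le[of _ "\<lambda>x. W (Complex x y)" y]])
      show "AE x in lborel. W (Complex x y) = U (Complex x y) * poly Q (cayley (Complex x y))"
        using y by (simp add: W_eq)
    qed (intro add_mono mult_left_mono D E y holomorphic_line_measurable hardy_fun_holomorphic[OF U]
        hardy_fun_holomorphic[OF W] order_refl zero_le)+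
  qed (use I in \<open>simp add: ennreal_mult_less_top\<close>)
  moreover have "(\<integral>\<^sup>+x. ennreal (norm (u x) powr p) \<partial>lborel) < \<infinity>"
  proof (rule le_less_trans[OF le[OF um wm, of 0]])
    show "AE x in lborel. w x = u x * poly Q (cayley (Complex x 0))"
      using eq by (simp add: complex_of_real_def)
  qed (use I uq wp in \<open>simp add: ennreal_mult_less_top\<close>)
  ultimately show ?thesis
    using l um by (simp add: hardy_bv_def)
qed

section \<open>Products of Hardy functions\<close>

text \<open>If Q(1) is not 0, then Q(r) stays away from 0 near infinity, so \<open>a\<close> decays
  no faster than a multiple of \<open>1 / x\<close>, whose integral diverges
  logarithmically.\<close>

lemma integrable_imp_poly_cayley_at_1:
  assumes int: "integrable lborel a"
    and eq: "AE x in lborel. a x = poly Q (cayley (of_real x)) / (complex_of_real x + \<i>)"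
  shows "poly Q 1 = 0"
proof (rule ccontr)
  assume "poly Q 1 \<noteq> 0"
  then obtain d M where d: "0 < d" and M: "\<And>z. M \<le> norm z \<Longrightarrow> d \<le> norm (poly Q (cayley z))"
    using poly_cayley_lower_bound by metis
  \<comment> \<open>\<open>1 \<le> m\<close> gives \<open>norm (x + \<i>) \<le> 2 * x\<close> beyond
    \<open>m\<close>, the origin of the 2 in \<open>2 / d\<close>.\<close>
  define m where "m = max M 1"
  have m: "M \<le> m" "1 \<le> m"
    by (auto simp: m_def)
  define k where "k = (\<integral>x. 2 / d * norm (a x) \<partial>lborel)"
  have i: "integrable lborel (\<lambda>x. 2 / d * norm (a x))"
    using int by simp
  have ineq: "1 / x \<le> 2 / d * norm (a x)"
    if x: "m \<le> x" and ax: "a x = poly Q (cayley (of_real x)) / (complex_of_real x + \<i>)" for x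
  proof -
    have "norm (complex_of_real x + \<i>) \<le> \<bar>x\<bar> + 1"
      using norm_triangle_ineq[of "complex_of_real x" \<i>] by simp
    then have n: "norm (complex_of_real x + \<i>) \<le> 2 * x" "0 < norm (complex_of_real x + \<i>)"
      using x m by auto
    have "d \<le> norm (poly Q (cayley (of_real x)))"
      using x m by (intro M) simp
    then have "d / (2 * x) \<le> norm (poly Q (cayley (of_real x))) / norm (complex_of_real x + \<i>)"
      using n d by (intro frac_le) auto
    then have "2 / d * (d / (2 * x)) \<le> 2 / d * norm (a x)"
      using d unfolding ax norm_divide by (intro mult_left_mono) auto
    then show ?thesis
      using d by simp
  qed
  \<comment> \<open>The interval from \<open>m\<close> to \<open>m * exp (k + 1)\<close> has
    logarithmic length \<open>k + 1\<close>, but the majorant \<open>2 / d * norm (a x)\<close> of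
    \<open>1 / x\<close> has total integral only \<open>k\<close>.\<close>
  have "ln (m * exp (k + 1)) - ln m \<le> k"
  proof -
    let ?b = "m * exp (k + 1)"
    have k0: "0 \<le> k"
      unfolding k_def using d by (intro integral_nonneg_AE) auto
    have b: "m \<le> ?b"
      using m k0 by (simp add: mult_le_cancel_left1)
    have "((\<lambda>x. 1 / x) has_integral (ln ?b - ln m)) {m..?b}"
      using m b by (intro fundamental_theorem_of_calculus)
        (auto intro!: derivative_eq_intros simp flip: has_real_derivative_iff_has_vector_derivative)
    then have "(\<integral>\<^sup>+x. ennreal (1 / x) * indicator {m..?b} x \<partial>lborel) = ennreal (ln ?b - ln m)"
      using m by (intro nn_integral_has_integral_lebesgue') auto
    moreover have "(\<integral>\<^sup>+x. ennreal (1 / x) * indicator {m..?b} x \<partial>lborel)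
        \<le> (\<integral>\<^sup>+x. ennreal (2 / d * norm (a x)) \<partial>lborel)"
    proof (rule nn_integral_mono_AE, use eq in eventually_elim)
      fix x assume "a x = poly Q (cayley (of_real x)) / (complex_of_real x + \<i>)"
      from ineq[OF _ this] show "ennreal (1 / x) * indicator {m..?b} x \<le> ennreal (2 / d * norm (a x))"
        by (cases "m \<le> x") (auto simp: indicator_def intro!: ennreal_leI)
    qed
    moreover have "(\<integral>\<^sup>+x. ennreal (2 / d * norm (a x)) \<partial>lborel) = ennreal k"
      unfolding k_def using d by (intro nn_integral_eq_integral i) auto
    ultimately show ?thesis
      using k0 by (simp add: ennreal_le_iff)
  qed
  moreover have "ln (m * exp (k + 1)) - ln m = k + 1"
    using m by (simp add: ln_mult)
  ultimately show False
    by simp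
qed

text \<open>The \<open>N\<close> poles of \<open>r\<^sup>N\<close> at \<open>-\<i>\<close> are extracted with
  \<open>(r t - r z) / (t - z) = 2\<i> / ((t + \<i>) (z + \<i>))\<close>; what remains is the Cauchy integral over the
  real line of a function of the lower half-plane, which vanishes at points of the upper one.\<close>

theorem hardy_product_rigidity:
  assumes pq: "1 < p" "1 / p + 1 / q = 1"
    and f1: "hardy_bv p f1 F1" and f2: "hardy_bv q f2 F2"
    and b1: "hardy_bv p b1 B1" and b2: "hardy_bv q b2 B2"
    and eq: "AE x in lborel. f1 x * f2 x = cayley (of_real x) ^ N * cnj (b1 x * b2 x)"
  obtains Q where "Q = 0 \<or> degree Q + 1 < N"
    "AE x in lborel. f1 x * f2 x = poly Q (cayley (of_real x)) / (complex_of_real x + \<i>)\<^sup>2"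
proof -
  define \<beta> where "\<beta> t = cnj (b1 t * b2 t)" for t
  from f1 f2 b1 b2 have [measurable]: "f1 \<in> borel_measurable lborel" "f2 \<in> borel_measurable lborel"
    "b1 \<in> borel_measurable lborel" "b2 \<in> borel_measurable lborel"
    by (auto simp: hardy_bv_def)
  have int_b: "integrable lborel (\<lambda>t. b1 t * b2 t)"
    using b1 b2 by (intro integrable_mult_powr[OF pq]) (auto simp: hardy_bv_def)
  have int_f: "integrable lborel (\<lambda>t. f1 t * f2 t)"
    using f1 f2 by (intro integrable_mult_powr[OF pq]) (auto simp: hardy_bv_def)
  have int_\<beta>: "integrable lborel \<beta>"
    unfolding \<beta>_def by (rule integrable_cnj[OF int_b])
  have \<beta>m [measurable]: "\<beta> \<in> borel_measurable lborel"
    using int_\<beta> by (rule borel_measurable_integrable)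
  have rm [measurable]: "(\<lambda>t. cayley (complex_of_real t)) \<in> borel_measurable lborel"
    unfolding cayley_def by measurable
  define J where "J j = (\<integral>t. cayley (of_real t) ^ j * \<beta> t / (of_real t + \<i>) \<partial>lborel)" for j
  have int_J: "integrable lborel (\<lambda>t. cayley (of_real t) ^ j * \<beta> t / (of_real t + \<i>))" for j
  proof (rule Bochner_Integration.integrable_bound[OF int_\<beta>])
    show "AE t in lborel. norm (cayley (of_real t) ^ j * \<beta> t / (of_real t + \<i>)) \<le> norm (\<beta> t)"
    proof (intro always_eventually allI)
      fix t
      have "norm (cayley (of_real t)) ^ j \<le> 1"
        by (intro power_le_one norm_cayley_le) auto
      moreover have "1 \<le> norm (complex_of_real t + \<i>)"
        using abs_Im_le_cmod[of "complex_of_real t + \<i>"] by simp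
      ultimately have "norm (cayley (of_real t)) ^ j * norm (\<beta> t) / norm (complex_of_real t + \<i>) \<le> 1 * norm (\<beta> t) / 1"
        by (intro frac_le mult_right_mono) auto
      then show "norm (cayley (of_real t) ^ j * \<beta> t / (of_real t + \<i>)) \<le> norm (\<beta> t)"
        by (simp add: norm_divide norm_mult norm_power)
    qed
  qed measurable
  \<comment> \<open>The j-th extracted term is
    \<open>2 * \<i> / (z + \<i>) * cayley z ^ (N - Suc j) * J j\<close>; dividing by the Cauchy
    factor \<open>2 * pi * \<i>\<close> leaves the coefficient \<open>J j / pi\<close>.\<close>
  define Q0 where "Q0 = (\<Sum>j<N. monom (J j / of_real pi) (N - Suc j))"
  have F: "F1 z * F2 z = poly Q0 (cayley z) * (1 / (z + \<i>))" if z: "0 < Im z" for z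
  proof -
    have zi: "z + \<i> \<noteq> 0"
      using z by (intro plus_i_nonzero) simp
    have tz: "complex_of_real t - z \<noteq> 0" for t
      using z by (auto simp: complex_eq_iff)
    have int_kernel: "integrable lborel (\<lambda>t. \<beta> t / (of_real t - z))"
    proof (rule Bochner_Integration.integrable_bound)
      show "integrable lborel (\<lambda>t. \<beta> t / of_real (Im z))"
        using int_\<beta> by simp
      show "AE t in lborel. norm (\<beta> t / (of_real t - z)) \<le> norm (\<beta> t / of_real (Im z))"
      proof (intro always_eventually allI)
        fix t
        have "\<bar>Im z\<bar> \<le> norm (complex_of_real t - z)"
          using abs_Im_le_cmod[of "of_real t - z"] by simp
        then show "norm (\<beta> t / (of_real t - z)) \<le> norm (\<beta> t / of_real (Im z))"
          using z by (simp add: norm_divide frac_le)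
      qed
    qed measurable
    have zero: "(\<integral>t. \<beta> t / (of_real t - z) \<partial>lborel) = 0"
    proof -
      have "(\<integral>t. \<beta> t / (of_real t - z) \<partial>lborel) = (\<integral>t. cnj (b1 t * b2 t / (of_real t - cnj z)) \<partial>lborel)"
        by (simp add: \<beta>_def)
      also have "\<dots> = cnj (\<integral>t. b1 t * b2 t / (of_real t - cnj z) \<partial>lborel)"
        by (rule Bochner_Integration.integral_cnj)
      also have "\<dots> = 0"
        using cauchy_integral_product[OF pq b1 b2, of "cnj z"] z by simp
      finally show ?thesis .
    qed
    have split: "cayley (of_real t) ^ N * \<beta> t / (of_real t - z) = cayley z ^ N * (\<beta> t / (of_real t - z))
        + (\<Sum>j<N. 2 * \<i> / (z + \<i>) * cayley z ^ (N - Suc j) * (cayley (of_real t) ^ j * \<beta> t / (of_real t + \<i>)))" for t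
    proof -
      have diff: "cayley (of_real t) - cayley z = (of_real t - z) * (2 * \<i> / ((of_real t + \<i>) * (z + \<i>)))"
      proof -
        have "cayley (of_real t) - cayley z
            = ((of_real t - \<i>) * (z + \<i>) - (z - \<i>) * (of_real t + \<i>)) / ((of_real t + \<i>) * (z + \<i>))"
          unfolding cayley_def using zi by (intro diff_frac_eq) auto
        also have "(of_real t - \<i>) * (z + \<i>) - (z - \<i>) * (of_real t + \<i>) = (of_real t - z) * (2 * \<i>)"
          by (simp add: algebra_simps)
        finally show ?thesis
          by simp
      qed
      have "cayley (of_real t) ^ N - cayley z ^ N
          = (cayley (of_real t) - cayley z) * (\<Sum>j<N. cayley z ^ (N - Suc j) * cayley (of_real t) ^ j)"
        by (rule power_diff_sumr2)
      then have "(cayley (of_real t) ^ N - cayley z ^ N) * \<beta> t / (of_real t - z)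
          = 2 * \<i> / ((of_real t + \<i>) * (z + \<i>)) * (\<Sum>j<N. cayley z ^ (N - Suc j) * cayley (of_real t) ^ j) * \<beta> t"
        using tz[of t] unfolding diff by simp
      also have "\<dots> = (\<Sum>j<N. 2 * \<i> / (z + \<i>) * cayley z ^ (N - Suc j) * (cayley (of_real t) ^ j * \<beta> t / (of_real t + \<i>)))"
        by (simp add: sum_distrib_left sum_distrib_right mult_ac)
      finally show ?thesis
        by (simp only: left_diff_distrib diff_divide_distrib times_divide_eq_right diff_eq_eq add.commute)
    qed
    have "2 * of_real pi * \<i> * (F1 z * F2 z) = (\<integral>t. f1 t * f2 t / (of_real t - z) \<partial>lborel)"
      using cauchy_integral_product[OF pq f1 f2, of z] z by simp
    also have "\<dots> = (\<integral>t. cayley (of_real t) ^ N * \<beta> t / (of_real t - z) \<partial>lborel)"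
    proof (rule integral_cong_AE)
      show "AE t in lborel. f1 t * f2 t / (of_real t - z) = cayley (of_real t) ^ N * \<beta> t / (of_real t - z)"
        using eq unfolding \<beta>_def by eventually_elim simp
    qed measurable
    also have "\<dots> = cayley z ^ N * (\<integral>t. \<beta> t / (of_real t - z) \<partial>lborel)
        + (\<Sum>j<N. 2 * \<i> / (z + \<i>) * cayley z ^ (N - Suc j) * J j)"
    proof -
      have i1: "integrable lborel (\<lambda>t. cayley z ^ N * (\<beta> t / (of_real t - z)))"
        by (intro integrable_mult_right int_kernel)
      have i2: "integrable lborel (\<lambda>t. 2 * \<i> / (z + \<i>) * cayley z ^ (N - Suc j)
          * (cayley (of_real t) ^ j * \<beta> t / (of_real t + \<i>)))" for j
        by (intro integrable_mult_right int_J)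
      show ?thesis
        unfolding split J_def Bochner_Integration.integral_add[OF i1 Bochner_Integration.integrable_sum[OF i2]]
          Bochner_Integration.integral_sum[OF i2]
        by (simp only: integral_mult_right_zero)
    qed
    also have "\<dots> = 2 * of_real pi * \<i> * (poly Q0 (cayley z) * (1 / (z + \<i>)))"
      by (simp add: zero Q0_def poly_sum poly_monom sum_distrib_left sum_distrib_right mult_ac sum_divide_distrib)
    finally show ?thesis
      by (subst (asm) mult_cancel_left) simp
  qed
  have AE_eq: "AE x in lborel. f1 x * f2 x = poly Q0 (cayley (of_real x)) * (1 / (of_real x + \<i>))"
  proof -
    have "AE x in lborel. nontangential_limit F1 x (f1 x)" "AE x in lborel. nontangential_limit F2 x (f2 x)"
      using f1 f2 by (auto simp: hardy_bv_def)
    then show ?thesis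
    proof eventually_elim
      case (elim x)
      have "nontangential_limit (\<lambda>z. poly Q0 (cayley z) * (1 / (z + \<i>))) x (f1 x * f2 x)"
        by (rule nontangential_limit_cong[OF F nontangential_limit_mult[OF elim]])
      moreover have "nontangential_limit (\<lambda>z. poly Q0 (cayley z) * (1 / (z + \<i>))) x
          (poly Q0 (cayley (of_real x)) * (1 / (of_real x + \<i>)))"
        by (intro nontangential_limit_mult nontangential_limit_isCont isCont_poly_cayley isCont_inverse_plus_i)
      ultimately show ?case
        by (rule nontangential_limit_unique)
    qed
  qed
  have "poly Q0 1 = 0"
    using AE_eq by (intro integrable_imp_poly_cayley_at_1[OF int_f]) simp
  then obtain Q1 where Q1: "Q0 = [:- 1, 1:] * Q1"
    by (auto simp: poly_eq_0_iff_dvd)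
  have deg0: "Q0 = 0 \<or> degree Q0 < N"
  proof (cases "N = 0")
    case False
    have "degree Q0 \<le> N - 1"
      unfolding Q0_def by (intro degree_sum_le) (auto intro: order_trans[OF degree_monom_le])
    then show ?thesis
      using False by linarith
  qed (simp add: Q0_def)
  show ?thesis
  proof (rule that)
    \<comment> \<open>\<open>Q0 = (r - 1) * Q1\<close>, and \<open>r - 1\<close> supplies both the
      second factor \<open>1 / (x + \<i>)\<close> and the constant. Division lowers the degree by
      one, hence \<open>+ 1\<close> in the bound.\<close>
    show "smult (- 2 * \<i>) Q1 = 0 \<or> degree (smult (- 2 * \<i>) Q1) + 1 < N"
    proof (cases "Q1 = 0")
      case False
      then have "degree Q0 = degree Q1 + 1"
        unfolding Q1 by (subst degree_mult_eq) auto
      then show ?thesis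
        using deg0 False by (auto simp: Q1)
    qed simp
    show "AE x in lborel. f1 x * f2 x = poly (smult (- 2 * \<i>) Q1) (cayley (of_real x)) / (complex_of_real x + \<i>)\<^sup>2"
      using AE_eq
    proof eventually_elim
      case (elim x)
      have "poly Q0 (cayley (of_real x)) = (cayley (of_real x) - 1) * poly Q1 (cayley (of_real x))"
        unfolding Q1 by (simp add: algebra_simps)
      then show ?case
        using elim by (simp add: cayley_minus_1 power2_eq_square)
    qed
  qed
qed

text \<open>A factor Q(r) with nonzero value at infinity can be divided out, while a zero at 1
  supplies the weight needed by \<open>hardy_bv_divide_plus_i\<close>. Applied below to both halves
  of the factorization.\<close>

lemma hardy_bv_mult_poly_cayley_iff:
  assumes p: "1 < p" "p \<le> q" and u: "hardy_bv q u U"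
  shows "(\<exists>F. hardy_bv p (\<lambda>x. u x * poly Q (cayley (of_real x))) F) \<longleftrightarrow>
    poly Q 1 = 0 \<or> (\<exists>F. hardy_bv p u F)"
proof
  assume "\<exists>F. hardy_bv p (\<lambda>x. u x * poly Q (cayley (of_real x))) F"
  then obtain F where F: "hardy_bv p (\<lambda>x. u x * poly Q (cayley (of_real x))) F"
    by blast
  show "poly Q 1 = 0 \<or> (\<exists>F. hardy_bv p u F)"
    using hardy_bv_of_mult_poly_cayley[OF p u F] by auto
next
  have p0: "0 \<le> p"
    using p by simp
  assume "poly Q 1 = 0 \<or> (\<exists>F. hardy_bv p u F)"
  then show "\<exists>F. hardy_bv p (\<lambda>x. u x * poly Q (cayley (of_real x))) F"
  proof
    assume "poly Q 1 = 0"
    then obtain Q1 where Q1: "Q = [:- 1, 1:] * Q1"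
      by (auto simp: poly_eq_0_iff_dvd)
    have "u x * (1 / (of_real x + \<i>)) * poly (smult (- 2 * \<i>) Q1) (cayley (of_real x))
        = u x * poly Q (cayley (of_real x))" for x
    proof -
      have "poly Q (cayley (of_real x)) = (cayley (of_real x) - 1) * poly Q1 (cayley (of_real x))"
        unfolding Q1 by (simp add: algebra_simps)
      then show ?thesis
        by (simp add: cayley_minus_1)
    qed
    then show ?thesis
      using hardy_bv_mult_poly_cayley[OF p0 hardy_bv_divide_plus_i[OF p u], of "smult (- 2 * \<i>) Q1"]
      by auto
  next
    assume "\<exists>F. hardy_bv p u F"
    then show ?thesis
      using hardy_bv_mult_poly_cayley[OF p0] by blast
  qed
qed

section \<open>Polynomials in r on the real line\<close>

lemma AE_poly_cayley_eq_0:
  assumes "AE x in lborel. poly Q (cayley (complex_of_real x)) = 0"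
  shows "Q = 0"
proof (rule ccontr)
  assume "Q \<noteq> 0"
  \<comment> \<open>r is injective on the line, so the finitely many roots have finitely many
    preimages, a null set.\<close>
  then have "finite ((\<lambda>x. cayley (complex_of_real x)) -` {w. poly Q w = 0})"
    by (intro finite_vimageI poly_roots_finite inj_cayley_of_real)
  then have "AE x in lborel. x \<notin> (\<lambda>x. cayley (complex_of_real x)) -` {w. poly Q w = 0}"
    by (intro AE_not_in finite_imp_null_set_lborel)
  then have "AE x::real in lborel. False"
    using assms by eventually_elim simp
  then show False
    by (simp add: AE_iff_null null_sets_def)
qed

text \<open>The conjugate reciprocal polynomial \<open>w^(n-1) * cnj (Q (1 / cnj w))\<close>,
  reversed at the nominal degree n - 1 and not at the degree of Q, so that the power of r produced
  by conjugation depends on n alone.\<close>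

definition refl_cnj_poly :: "nat \<Rightarrow> complex poly \<Rightarrow> complex poly" where
  "refl_cnj_poly n Q = (\<Sum>j<n. monom (cnj (coeff Q j)) (n - Suc j))"

lemma poly_eq_sum_lessThan:
  fixes Q :: "complex poly"
  assumes "Q = 0 \<or> degree Q < n"
  shows "poly Q x = (\<Sum>j<n. coeff Q j * x ^ j)"
proof (cases "Q = 0")
  case False
  have "poly Q x = (\<Sum>j\<le>degree Q. coeff Q j * x ^ j)"
    by (rule poly_altdef)
  also have "\<dots> = (\<Sum>j<n. coeff Q j * x ^ j)"
    using False assms by (intro sum.mono_neutral_left) (auto simp: coeff_eq_0)
  finally show ?thesis .
qed simp

lemma poly_refl_cnj_poly:
  assumes "Q = 0 \<or> degree Q < n" and w: "w \<noteq> 0" "cnj w = inverse w"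
  shows "poly (refl_cnj_poly n Q) w = cnj (poly Q w) * w ^ (n - 1)"
proof -
  have "cnj (poly Q w) * w ^ (n - 1) = (\<Sum>j<n. cnj (coeff Q j) * (inverse w ^ j * w ^ (n - 1)))"
    unfolding poly_eq_sum_lessThan[OF assms(1)] by (simp add: w sum_distrib_right mult.assoc)
  also have "\<dots> = (\<Sum>j<n. cnj (coeff Q j) * w ^ (n - Suc j))"
  proof (rule sum.cong)
    fix j assume "j \<in> {..<n}"
    then have "w ^ (n - 1) = w ^ j * w ^ (n - Suc j)"
      by (simp flip: power_add)
    then show "cnj (coeff Q j) * (inverse w ^ j * w ^ (n - 1)) = cnj (coeff Q j) * w ^ (n - Suc j)"
      using w(1) by (simp add: power_inverse)
  qed simp
  finally show ?thesis
    by (simp add: refl_cnj_poly_def poly_sum poly_monom)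
qed

section \<open>Representatives\<close>

text \<open>A chosen representative respects the operations only almost everywhere. The
  \<open>mval\<close> rules record this, and identities between classes are then proved
  pointwise.\<close>

abbreviation mval :: "mfun \<Rightarrow> real \<Rightarrow> complex" where
  "mval \<equiv> rep_mfun"

lemma ae_rel_mval: "ae_rel (mval a) (mval a)"
  by (rule Quotient3_rep_reflp[OF Quotient3_mfun])

lemma abs_mval: "abs_mfun (mval a) = a"
  by (rule Quotient3_abs_rep[OF Quotient3_mfun])

lemma mval_measurable [measurable]: "mval a \<in> borel_measurable lborel"
  using ae_rel_mval[of a] by (simp add: ae_rel_def)

lemma mfun_eq_iff: "a = b \<longleftrightarrow> (AE x in lborel. mval a x = mval b x)"
  using Quotient3_rel_rep[OF Quotient3_mfun, of a b] mval_measurable by (auto simp: ae_rel_def)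

lemma mval_abs:
  assumes "f \<in> borel_measurable lborel"
  shows "AE x in lborel. mval (abs_mfun f) x = f x"
  using Quotient3_rep_abs[OF Quotient3_mfun, of f] assms by (simp add: ae_rel_def)

lemma mval_0: "AE x in lborel. mval 0 x = 0"
  unfolding zero_mfun.abs_eq by (rule mval_abs) simp

lemma mval_1: "AE x in lborel. mval 1 x = 1"
  unfolding one_mfun.abs_eq by (rule mval_abs) simp

lemma mval_const: "AE x in lborel. mval (const_mf c) x = c"
  unfolding const_mf.abs_eq by (rule mval_abs) simp

lemma mval_xi: "AE x in lborel. mval xi x = of_real x"
  unfolding xi.abs_eq by (rule mval_abs) simp

lemma mval_add: "AE x in lborel. mval (a + b) x = mval a x + mval b x"
  using mval_abs[of "\<lambda>x. mval a x + mval b x"] plus_mfun.abs_eq[OF ae_rel_mval[of a] ae_rel_mval[of b]]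
  by (simp add: abs_mval)

lemma mval_diff: "AE x in lborel. mval (a - b) x = mval a x - mval b x"
  using mval_abs[of "\<lambda>x. mval a x - mval b x"] minus_mfun.abs_eq[OF ae_rel_mval[of a] ae_rel_mval[of b]]
  by (simp add: abs_mval)

lemma mval_mult: "AE x in lborel. mval (a * b) x = mval a x * mval b x"
  using mval_abs[of "\<lambda>x. mval a x * mval b x"] times_mfun.abs_eq[OF ae_rel_mval[of a] ae_rel_mval[of b]]
  by (simp add: abs_mval)

lemma mval_inverse: "AE x in lborel. mval (inverse a) x = inverse (mval a x)"
  using mval_abs[of "\<lambda>x. inverse (mval a x)"] inverse_mfun.abs_eq[OF ae_rel_mval[of a]]
  by (simp add: abs_mval)

lemma mval_divide: "AE x in lborel. mval (a / b) x = mval a x / mval b x"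
  unfolding divide_mfun_def using mval_mult[of a "inverse b"] mval_inverse[of b]
  by eventually_elim (simp add: divide_inverse)

lemma cnj_measurable [measurable]: "f \<in> borel_measurable M \<Longrightarrow> (\<lambda>x. cnj (f x)) \<in> borel_measurable M"
  by (rule borel_measurable_continuous_on[where f = cnj]) (auto intro: continuous_intros)

lemma mval_cnj: "AE x in lborel. mval (cnj_mf a) x = cnj (mval a x)"
  using mval_abs[of "\<lambda>x. cnj (mval a x)"] cnj_mf.abs_eq[OF ae_rel_mval[of a]]
  by (simp add: abs_mval cnj_measurable mval_measurable)

lemma mval_power: "AE x in lborel. mval (a ^ n) x = mval a x ^ n"
proof (induction n)
  case 0
  then show ?case
    using mval_1 by simp
next
  case (Suc n)
  then show ?case
    using mval_mult[of a "a ^ n"] by eventually_elim simp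
qed

lemma mval_power_int: "AE x in lborel. mval (a powi k) x = mval a x powi k"
proof (cases "0 \<le> k")
  case True
  then show ?thesis
    using mval_power[of a "nat k"] by (simp add: power_int_def)
next
  case False
  have "AE x in lborel. mval (inverse a ^ nat (- k)) x = inverse (mval a x) ^ nat (- k)"
    using mval_power[of "inverse a" "nat (- k)"] mval_inverse[of a] by eventually_elim simp
  then show ?thesis
    using False by (simp add: power_int_def)
qed

lemma mval_sum:
  assumes "finite A"
  shows "AE x in lborel. mval (\<Sum>a\<in>A. f a) x = (\<Sum>a\<in>A. mval (f a) x)"
  using assms
proof (induction A rule: finite_induct)
  case empty
  then show ?case
    using mval_0 by simp
next
  case (insert a A)
  show ?case
    using insert.IH mval_add[of "f a" "sum f A"] by eventually_elim (simp add: insert.hyps)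
qed

lemma mval_scale: "AE x in lborel. mval (scale_mf c a) x = c * mval a x"
  unfolding scale_mf_def using mval_mult[of "const_mf c" a] mval_const[of c] by eventually_elim simp

lemma mval_xi_plus_i: "AE x in lborel. mval xi_plus_i x = of_real x + \<i>"
  unfolding xi_plus_i_def using mval_add[of xi "const_mf \<i>"] mval_xi mval_const[of \<i>]
  by eventually_elim simp

lemma mval_xi_minus_i: "AE x in lborel. mval xi_minus_i x = of_real x - \<i>"
  unfolding xi_minus_i_def using mval_diff[of xi "const_mf \<i>"] mval_xi mval_const[of \<i>]
  by eventually_elim simp

lemma mval_r: "AE x in lborel. mval r_mf x = cayley (of_real x)"
  unfolding r_mf_def cayley_def using mval_divide[of xi_minus_i xi_plus_i] mval_xi_plus_i mval_xi_minus_i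
  by eventually_elim simp

lemma nonzero_ae_iff: "nonzero_ae a \<longleftrightarrow> (AE x in lborel. mval a x \<noteq> 0)"
  using nonzero_ae.abs_eq[OF ae_rel_mval[of a]] by (simp add: abs_mval)

lemma hardy_plus_iff: "a \<in> hardy_plus p \<longleftrightarrow> (\<exists>F. hardy_bv p (mval a) F)"
  using mem_Lp.abs_eq[OF ae_rel_mval[of a], of p] boundary_value.abs_eq[OF ae_rel_mval[of a]] mval_measurable[of a]
  by (auto simp: hardy_plus_def Lp_def hardy_bv_def abs_mval)

lemma ex_hardy_bv_cong_AE:
  assumes "AE x in lborel. f x = g x" "f \<in> borel_measurable lborel" "g \<in> borel_measurable lborel"
  shows "(\<exists>F. hardy_bv p f F) \<longleftrightarrow> (\<exists>F. hardy_bv p g F)"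
proof -
  have "AE x in lborel. g x = f x"
    using assms(1) by eventually_elim simp
  then show ?thesis
    using hardy_bv_cong_AE assms by blast
qed

text \<open>Conjugation is an involution, so the image under \<open>cnj_mf\<close> becomes a
  preimage.\<close>

lemma hardy_minus_iff: "a \<in> hardy_minus p \<longleftrightarrow> (\<exists>F. hardy_bv p (\<lambda>x. cnj (mval a x)) F)"
proof -
  have inv: "cnj_mf (cnj_mf b) = b" for b
    unfolding mfun_eq_iff using mval_cnj[of "cnj_mf b"] mval_cnj[of b] by eventually_elim simp
  then have "a \<in> hardy_minus p \<longleftrightarrow> cnj_mf a \<in> hardy_plus p"
    unfolding hardy_minus_def by (metis image_iff)
  also have "\<dots> \<longleftrightarrow> (\<exists>F. hardy_bv p (\<lambda>x. cnj (mval a x)) F)"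
    unfolding hardy_plus_iff
    by (rule ex_hardy_bv_cong_AE[OF mval_cnj]) measurable
  finally show ?thesis .
qed

text \<open>\<open>\<xi> + \<i>\<close> has no real zero, so multiplication by
  \<open>xi_plus_i\<close> is invertible and the image becomes pointwise division.\<close>

lemma cal_hardy_plus_iff:
  "a \<in> cal_hardy_plus p \<longleftrightarrow> (\<exists>F. hardy_bv p (\<lambda>x. mval a x / (of_real x + \<i>)) F)"
proof -
  let ?b = "inverse xi_plus_i * a"
  have b: "AE x in lborel. mval ?b x = mval a x / (of_real x + \<i>)"
    using mval_mult[of "inverse xi_plus_i" a] mval_inverse[of xi_plus_i] mval_xi_plus_i
    by eventually_elim (simp add: field_simps)
  have "xi_plus_i * ?b = a"
    unfolding mfun_eq_iff using mval_mult[of xi_plus_i ?b] b mval_xi_plus_i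
    by eventually_elim simp
  moreover have "inverse xi_plus_i * (xi_plus_i * c) = c" for c
    unfolding mfun_eq_iff
    using mval_mult[of "inverse xi_plus_i" "xi_plus_i * c"] mval_mult[of xi_plus_i c]
      mval_inverse[of xi_plus_i] mval_xi_plus_i
    by eventually_elim simp
  ultimately have "a \<in> cal_hardy_plus p \<longleftrightarrow> ?b \<in> hardy_plus p"
    unfolding cal_hardy_plus_def by (metis image_iff)
  also have "\<dots> \<longleftrightarrow> (\<exists>F. hardy_bv p (\<lambda>x. mval a x / (of_real x + \<i>)) F)"
    unfolding hardy_plus_iff by (rule ex_hardy_bv_cong_AE[OF b]) measurable
  finally show ?thesis .
qed

lemma cal_hardy_minus_iff:
  "a \<in> cal_hardy_minus p \<longleftrightarrow> (\<exists>F. hardy_bv p (\<lambda>x. cnj (mval a x / (of_real x - \<i>))) F)"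
proof -
  let ?b = "inverse xi_minus_i * a"
  have b: "AE x in lborel. mval ?b x = mval a x / (of_real x - \<i>)"
    using mval_mult[of "inverse xi_minus_i" a] mval_inverse[of xi_minus_i] mval_xi_minus_i
    by eventually_elim (simp add: field_simps)
  have "xi_minus_i * ?b = a"
    unfolding mfun_eq_iff using mval_mult[of xi_minus_i ?b] b mval_xi_minus_i
    by eventually_elim simp
  moreover have "inverse xi_minus_i * (xi_minus_i * c) = c" for c
    unfolding mfun_eq_iff
    using mval_mult[of "inverse xi_minus_i" "xi_minus_i * c"] mval_mult[of xi_minus_i c]
      mval_inverse[of xi_minus_i] mval_xi_minus_i
    by eventually_elim simp
  ultimately have "a \<in> cal_hardy_minus p \<longleftrightarrow> ?b \<in> hardy_minus p"
    unfolding cal_hardy_minus_def by (metis image_iff)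
  also have "\<dots> \<longleftrightarrow> (\<exists>F. hardy_bv p (\<lambda>x. cnj (mval a x / (of_real x - \<i>))) F)"
  proof -
    have "AE x in lborel. cnj (mval ?b x) = cnj (mval a x / (of_real x - \<i>))"
      using b by eventually_elim simp
    then show ?thesis
      unfolding hardy_minus_iff by (rule ex_hardy_bv_cong_AE) measurable
  qed
  finally show ?thesis .
qed

section \<open>The spaces \<open>K_r\<close> as polynomials in r, and their dimension\<close>

lemma mval_K_r_generator:
  "AE x in lborel. mval (1 / xi_plus_i * r_mf ^ j) x = cayley (of_real x) ^ j / (of_real x + \<i>)"
  using mval_mult[of "1 / xi_plus_i" "r_mf ^ j"] mval_divide[of 1 xi_plus_i] mval_1 mval_xi_plus_i
    mval_power[of r_mf j] mval_r
  by eventually_elim simp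

text \<open>Spans become polynomials through coefficients. The alternative \<open>Q = 0\<close> is
  explicit because \<open>degree 0 = 0\<close>; with n = 0 it is the only one left.\<close>

lemma mem_K_r_iff:
  "a \<in> K_r n \<longleftrightarrow> (\<exists>Q. (Q = 0 \<or> degree Q < n) \<and>
    (AE x in lborel. mval a x = poly Q (cayley (of_real x)) / (of_real x + \<i>)))"
proof
  let ?S = "{a. \<exists>Q. (Q = 0 \<or> degree Q < n) \<and>
    (AE x in lborel. mval a x = poly Q (cayley (of_real x)) / (of_real x + \<i>))}"
  assume "a \<in> K_r n"
  moreover have "K_r n \<subseteq> ?S"
    unfolding K_r_def
  proof (rule mf.span_minimal)
    show "{1 / xi_plus_i * r_mf ^ j |j. j < n} \<subseteq> ?S"
    proof safe
      fix j assume "j < n"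
      then show "\<exists>Q. (Q = 0 \<or> degree Q < n) \<and>
          (AE x in lborel. mval (1 / xi_plus_i * r_mf ^ j) x = poly Q (cayley (of_real x)) / (of_real x + \<i>))"
        using mval_K_r_generator[of j]
        by (intro exI[of _ "monom 1 j"]) (auto simp: degree_monom_eq poly_monom)
    qed
    show "mf.subspace ?S"
    proof (rule mf.subspaceI)
      show "0 \<in> ?S"
        using mval_0 by (auto intro!: exI[of _ 0])
    next
      fix a b assume "a \<in> ?S" "b \<in> ?S"
      then obtain P Q where PQ: "P = 0 \<or> degree P < n" "Q = 0 \<or> degree Q < n"
        "AE x in lborel. mval a x = poly P (cayley (of_real x)) / (of_real x + \<i>)"
        "AE x in lborel. mval b x = poly Q (cayley (of_real x)) / (of_real x + \<i>)"
        by auto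
      have "P + Q = 0 \<or> degree (P + Q) < n"
        using PQ(1,2) degree_add_less[of P n Q] by auto
      moreover have "AE x in lborel. mval (a + b) x = poly (P + Q) (cayley (of_real x)) / (of_real x + \<i>)"
        using PQ(3,4) mval_add[of a b] by eventually_elim (simp add: add_divide_distrib)
      ultimately show "a + b \<in> ?S"
        by blast
    next
      fix c a assume "a \<in> ?S"
      then obtain Q where Q: "Q = 0 \<or> degree Q < n"
        "AE x in lborel. mval a x = poly Q (cayley (of_real x)) / (of_real x + \<i>)"
        by auto
      have "smult c Q = 0 \<or> degree (smult c Q) < n"
        using Q(1) degree_smult_le[of c Q] by auto
      moreover have "AE x in lborel. mval (scale_mf c a) x = poly (smult c Q) (cayley (of_real x)) / (of_real x + \<i>)"
        using Q(2) mval_scale[of c a] by eventually_elim simp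
      ultimately show "scale_mf c a \<in> ?S"
        by blast
    qed
  qed
  ultimately show "\<exists>Q. (Q = 0 \<or> degree Q < n) \<and>
    (AE x in lborel. mval a x = poly Q (cayley (of_real x)) / (of_real x + \<i>))"
    by blast
next
  assume "\<exists>Q. (Q = 0 \<or> degree Q < n) \<and>
    (AE x in lborel. mval a x = poly Q (cayley (of_real x)) / (of_real x + \<i>))"
  then obtain Q where Q: "Q = 0 \<or> degree Q < n"
    "AE x in lborel. mval a x = poly Q (cayley (of_real x)) / (of_real x + \<i>)"
    by blast
  let ?b = "\<Sum>j<n. scale_mf (coeff Q j) (1 / xi_plus_i * r_mf ^ j)"
  have "AE x in lborel. \<forall>j\<in>{..<n}. mval (scale_mf (coeff Q j) (1 / xi_plus_i * r_mf ^ j)) x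
      = coeff Q j * (cayley (of_real x) ^ j / (of_real x + \<i>))"
  proof (rule AE_finite_allI)
    fix j
    show "AE x in lborel. mval (scale_mf (coeff Q j) (1 / xi_plus_i * r_mf ^ j)) x
      = coeff Q j * (cayley (of_real x) ^ j / (of_real x + \<i>))"
      using mval_scale[of "coeff Q j" "1 / xi_plus_i * r_mf ^ j"] mval_K_r_generator[of j]
      by eventually_elim simp
  qed simp
  then have "AE x in lborel. mval a x = mval ?b x"
    using Q(2) mval_sum[OF finite_lessThan, of "\<lambda>j. scale_mf (coeff Q j) (1 / xi_plus_i * r_mf ^ j)" n]
    by eventually_elim (simp add: poly_eq_sum_lessThan[OF Q(1)] sum_divide_distrib)
  then have "a = ?b"
    by (simp add: mfun_eq_iff)
  also have "?b \<in> K_r n"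
    unfolding K_r_def by (intro mf.span_sum mf.span_scale mf.span_base) auto
  finally show "a \<in> K_r n" .
qed

text \<open>Since \<open>c\<close> can be cancelled almost everywhere, a linear relation among the
  images of the generators is a polynomial in r that vanishes almost everywhere, hence the zero
  polynomial.\<close>

lemma has_dimension_mult_K_r:
  assumes c: "AE x in lborel. mval c x \<noteq> 0"
  shows "has_dimension ((\<lambda>f. c * f) ` K_r n) n"
proof -
  define e where "e j = c * (1 / xi_plus_i * r_mf ^ j)" for j
  have e: "AE x in lborel. mval (e j) x = mval c x * (cayley (of_real x) ^ j / (of_real x + \<i>))" for j
    unfolding e_def using mval_mult[of c "1 / xi_plus_i * r_mf ^ j"] mval_K_r_generator[of j]
    by eventually_elim simp
  have lin: "module_hom scale_mf scale_mf (\<lambda>f. c * f)"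
    by unfold_locales (simp_all add: scale_mf_def distrib_left mult.left_commute)
  have "(\<lambda>f. c * f) ` K_r n = mf.span ((\<lambda>f. c * f) ` {1 / xi_plus_i * r_mf ^ j |j. j < n})"
    unfolding K_r_def
    by (rule module_hom.span_image[OF lin, symmetric])
  also have "(\<lambda>f. c * f) ` {1 / xi_plus_i * r_mf ^ j |j. j < n} = e ` {..<n}"
    by (auto simp: e_def)
  finally have V: "(\<lambda>f. c * f) ` K_r n = mf.span (e ` {..<n})" .
  have coeffs: "w j = 0" if sum: "(\<Sum>j<n. scale_mf (w j) (e j)) = 0" and j: "j < n" for w j
  proof -
    define Q where "Q = (\<Sum>j<n. monom (w j) j)"
    have "AE x in lborel. \<forall>j\<in>{..<n}. mval (scale_mf (w j) (e j)) x
        = w j * (mval c x * (cayley (of_real x) ^ j / (of_real x + \<i>)))"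
    proof (rule AE_finite_allI)
      fix j
      show "AE x in lborel. mval (scale_mf (w j) (e j)) x
        = w j * (mval c x * (cayley (of_real x) ^ j / (of_real x + \<i>)))"
        using mval_scale[of "w j" "e j"] e[of j] by eventually_elim simp
    qed simp
    then have "AE x in lborel. poly Q (cayley (of_real x)) = 0"
      using mval_sum[OF finite_lessThan, of "\<lambda>j. scale_mf (w j) (e j)" n] mval_0 c
    proof eventually_elim
      case (elim x)
      have "0 = (\<Sum>j<n. w j * (mval c x * (cayley (of_real x) ^ j / (of_real x + \<i>))))"
        using elim by (simp add: sum)
      also have "\<dots> = mval c x / (of_real x + \<i>) * poly Q (cayley (of_real x))"
        by (simp add: Q_def poly_sum poly_monom sum_distrib_left mult_ac)
      finally show ?case
        using elim by simp
    qed
    then have "Q = 0"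
      by (rule AE_poly_cayley_eq_0)
    then have "coeff Q j = 0"
      by simp
    then show ?thesis
      using j by (simp add: Q_def coeff_sum)
  qed
  \<comment> \<open>The dimension is the cardinality of the image set, so distinctness matters. If
    \<open>e i = e j\<close>, the difference of two Kronecker deltas is a relation, and its
    coefficient at i must vanish.\<close>
  have inj: "inj_on e {..<n}"
  proof (rule inj_onI)
    fix i j assume ij: "i \<in> {..<n}" "j \<in> {..<n}" "e i = e j"
    let ?w = "\<lambda>k. (if k = i then 1 else 0) - (if k = j then 1 else 0 :: complex)"
    have "(\<Sum>k<n. scale_mf (?w k) (e k)) = (\<Sum>k<n. (if k = i then e k else 0) - (if k = j then e k else 0))"
      by (intro sum.cong) (auto simp: mf.scale_left_diff_distrib)
    also have "\<dots> = 0"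
      using ij by (simp add: sum_subtractf)
    finally have "?w i = 0"
      using ij coeffs[of ?w i] by blast
    then show "i = j"
      by (auto split: if_splits)
  qed
  have indep: "mf.independent (e ` {..<n})"
  proof
    assume "mf.dependent (e ` {..<n})"
    then obtain u j where u: "(\<Sum>v\<in>e ` {..<n}. scale_mf (u v) v) = 0" "j < n" "u (e j) \<noteq> 0"
      by (auto simp: mf.dependent_finite)
    have "(\<Sum>j<n. scale_mf (u (e j)) (e j)) = 0"
      using u(1) by (simp add: sum.reindex[OF inj])
    then show False
      using coeffs[of "\<lambda>j. u (e j)" j] u by simp
  qed
  have "mf.dim (mf.span (e ` {..<n})) = n"
    using mf.dim_span_eq_card_independent[OF indep] by (simp add: card_image[OF inj])
  then show ?thesis
    unfolding has_dimension_def V by (auto intro!: exI[of _ "e ` {..<n}"])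
qed

section \<open>The kernel of the Toeplitz operator\<close>

text \<open>Both conditions that cut the kernel out of the candidates \<open>u Q(r)\<close>, namely \<open>\<phi> \<in> H\<^sub>p\<^sup>+\<close> and
  \<open>g \<phi> \<in> H\<^sub>p\<^sup>-\<close>, have the same shape: up to conjugation \<open>g \<phi>\<close> is \<open>v\<close> times the reflected polynomial
  in \<open>r\<close>, since \<open>cnj r = 1 / r\<close> on the real line.\<close>

theorem mem_toeplitz_ker_iff:
  assumes p: "1 < p" "p \<le> q" and pp: "1 / p + 1 / p' = 1"
    and fact: "pq_factorization q p' g gm k gp"
  shows "\<phi> \<in> toeplitz_ker p g \<longleftrightarrow> (\<exists>Q. (Q = 0 \<or> degree Q < nat (- k)) \<and>
    (AE x in lborel. mval \<phi> x = inverse (mval gp x) / (of_real x + \<i>) * poly Q (cayley (of_real x))) \<and>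
    (poly Q 1 = 0 \<or> gm \<in> cal_hardy_minus p \<and> inverse gp \<in> cal_hardy_plus p))"
proof -
  define n where "n = nat (- k)"
  \<comment> \<open>\<open>f2\<close> is the \<open>h\<close> of the overview. \<open>v\<close> and
    \<open>b2\<close> are conjugated, so that all four functions are boundary values from the upper
    half-plane.\<close>
  define u where "u x = inverse (mval gp x) / (of_real x + \<i>)" for x
  define v where "v x = cnj (mval gm x / (of_real x - \<i>))" for x
  define f2 where "f2 x = mval gp x / (of_real x + \<i>)" for x
  define b2 where "b2 x = cnj (inverse (mval gm x) / (of_real x - \<i>))" for x
  have [measurable]: "u \<in> borel_measurable lborel" "v \<in> borel_measurable lborel"
    "f2 \<in> borel_measurable lborel" "b2 \<in> borel_measurable lborel"
    unfolding u_def v_def f2_def b2_def by measurable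
  have [measurable]: "(\<lambda>x. poly Q (cayley (complex_of_real x))) \<in> borel_measurable lborel" for Q
    by (intro borel_measurable_lborel_continuous
        continuous_on_compose2[OF holomorphic_on_imp_continuous_on[OF holomorphic_on_poly_cayley]] continuous_intros) auto
  from fact have nz: "AE x in lborel. mval gm x \<noteq> 0" "AE x in lborel. mval gp x \<noteq> 0"
    by (auto simp: pq_factorization_def nonzero_ae_iff)
  have g_eq: "g = gm * r_mf powi k * gp"
    using fact by (simp add: pq_factorization_def)
  have g: "AE x in lborel. mval g x = mval gm x * cayley (of_real x) powi k * mval gp x"
    unfolding g_eq
    using mval_mult[of "gm * r_mf powi k" gp] mval_mult[of gm "r_mf powi k"] mval_power_int[of r_mf k] mval_r
    by eventually_elim simp
  have inv_iff: "inverse gp \<in> cal_hardy_plus s \<longleftrightarrow> (\<exists>F. hardy_bv s u F)" for s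
  proof -
    have "AE x in lborel. mval (inverse gp) x / (of_real x + \<i>) = u x"
      unfolding u_def using mval_inverse[of gp] by eventually_elim simp
    then show ?thesis
      unfolding cal_hardy_plus_iff by (rule ex_hardy_bv_cong_AE) measurable
  qed
  have gm_iff: "gm \<in> cal_hardy_minus s \<longleftrightarrow> (\<exists>F. hardy_bv s v F)" for s
    unfolding cal_hardy_minus_iff v_def ..
  obtain U where U: "hardy_bv q u U"
    using fact by (auto simp: pq_factorization_def inv_iff)
  obtain V where V: "hardy_bv q v V"
    using fact by (auto simp: pq_factorization_def gm_iff)
  obtain F2 where F2: "hardy_bv p' f2 F2"
    using fact by (auto simp: pq_factorization_def cal_hardy_plus_iff f2_def[abs_def])
  obtain B2 where B2: "hardy_bv p' b2 B2"
  proof -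
    obtain F where "hardy_bv p' (\<lambda>x. cnj (mval (inverse gm) x / (of_real x - \<i>))) F"
      using fact by (auto simp: pq_factorization_def cal_hardy_minus_iff)
    moreover have "AE x in lborel. cnj (mval (inverse gm) x / (of_real x - \<i>)) = b2 x"
      unfolding b2_def using mval_inverse[of gm] by eventually_elim simp
    ultimately have "hardy_bv p' b2 F"
      by (rule hardy_bv_cong_AE) measurable
    then show ?thesis
      by (rule that)
  qed
  have representation: "\<exists>Q. (Q = 0 \<or> degree Q < n) \<and> (AE x in lborel. mval \<phi> x = u x * poly Q (cayley (of_real x)))"
    if \<phi>: "\<phi> \<in> toeplitz_ker p g"
  proof -
    \<comment> \<open>The factor r^(k-1) is split by sign, \<open>k - 1 = m - N\<close> with at most
      one of them nonzero: a nonnegative power stays on the side of \<open>\<phi>\<close> as a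
      bounded multiplier, a negative one moves to the conjugate side.\<close>
    define m where "m = nat (k - 1)"
    define N where "N = nat (1 - k)"
    obtain F1 where F1: "hardy_bv p (mval \<phi>) F1"
      using \<phi> by (auto simp: toeplitz_ker_eq hardy_plus_iff)
    obtain B1 where B1: "hardy_bv p (\<lambda>x. cnj (mval (g * \<phi>) x)) B1"
      using \<phi> by (auto simp: toeplitz_ker_eq hardy_minus_iff)
    have F1': "hardy_bv p (\<lambda>x. mval \<phi> x * poly (monom 1 m) (cayley (of_real x))) (\<lambda>z. F1 z * poly (monom 1 m) (cayley z))"
      using p by (intro hardy_bv_mult_poly_cayley F1) simp
    have "AE x in lborel. mval \<phi> x * poly (monom 1 m) (cayley (of_real x)) * f2 x
        = cayley (of_real x) ^ N * cnj (cnj (mval (g * \<phi>) x) * b2 x)"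
      using g nz mval_mult[of g \<phi>]
    proof eventually_elim
      case (elim x)
      let ?r = "cayley (complex_of_real x)"
      have r: "?r ^ m = ?r ^ N * ?r powi k / ?r"
      proof (cases "1 \<le> k")
        case True
        then have "k = int m + 1" "N = 0"
          by (auto simp: m_def N_def)
        then show ?thesis
          by (simp add: power_int_add)
      next
        case False
        then have "k = 1 - int N" "m = 0"
          by (auto simp: m_def N_def)
        then show ?thesis
          by (simp add: power_int_diff)
      qed
      have ri: "1 / (?r * (of_real x - \<i>)) * (of_real x - \<i>) = 1 / ?r" "?r * (of_real x + \<i>) = of_real x - \<i>"
        by (simp_all add: cayley_def)
      have "mval \<phi> x * poly (monom 1 m) ?r * f2 x = mval \<phi> x * ?r ^ N * ?r powi k * mval gp x / (?r * (of_real x + \<i>))"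
        unfolding f2_def poly_monom r by simp
      also have "\<dots> = ?r ^ N * cnj (cnj (mval (g * \<phi>) x) * b2 x)"
        unfolding ri(2) b2_def using elim by (simp add: mult_ac)
      finally show ?case .
    qed
    then obtain Q where Q: "Q = 0 \<or> degree Q + 1 < N"
      "AE x in lborel. mval \<phi> x * poly (monom 1 m) (cayley (of_real x)) * f2 x
        = poly Q (cayley (of_real x)) / (complex_of_real x + \<i>)\<^sup>2"
      by (rule hardy_product_rigidity[OF p(1) pp F1' F2 B1 B2])
    have "Q = 0 \<or> degree Q < n"
      using Q(1) by (auto simp: n_def N_def)
    moreover have "AE x in lborel. mval \<phi> x = u x * poly Q (cayley (of_real x))"
      using Q(2) nz(2)
    proof eventually_elim
      case (elim x)
      show ?case
      proof (cases "Q = 0")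
        case True
        then show ?thesis
          using elim by (simp add: f2_def poly_monom)
      next
        case False
        \<comment> \<open>A nonzero \<open>Q\<close> requires \<open>N > 1\<close>, so k is negative
          and \<open>\<phi>\<close> was not multiplied by a power of r.\<close>
        then have "m = 0"
          using Q(1) by (auto simp: m_def N_def)
        then have \<phi>f2: "mval \<phi> x * f2 x = poly Q (cayley (of_real x)) / (complex_of_real x + \<i>)\<^sup>2"
          using elim by (simp add: poly_monom)
        have "mval \<phi> x = (mval \<phi> x * f2 x) * ((of_real x + \<i>) / mval gp x)"
          using elim by (simp add: f2_def)
        also have "\<dots> = u x * poly Q (cayley (of_real x))"
          unfolding \<phi>f2 u_def by (simp add: divide_inverse power2_eq_square)
        finally show ?thesis .
      qed
    qed
    ultimately show ?thesis
      by blast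
  qed
  have mem: "\<phi> \<in> toeplitz_ker p g \<longleftrightarrow> poly Q 1 = 0 \<or> gm \<in> cal_hardy_minus p \<and> inverse gp \<in> cal_hardy_plus p"
    if Q: "Q = 0 \<or> degree Q < n" and \<phi>: "AE x in lborel. mval \<phi> x = u x * poly Q (cayley (of_real x))" for Q
  proof -
    let ?R = "refl_cnj_poly n Q"
    \<comment> \<open>1 lies on the unit circle and all its powers are 1, so reflection merely
      conjugates the value there.\<close>
    have R1: "poly ?R 1 = 0 \<longleftrightarrow> poly Q 1 = 0"
      using poly_refl_cnj_poly[OF Q, of 1] by simp
    have plus: "\<phi> \<in> hardy_plus p \<longleftrightarrow> (\<exists>F. hardy_bv p (\<lambda>x. u x * poly Q (cayley (of_real x))) F)"
      unfolding hardy_plus_iff by (rule ex_hardy_bv_cong_AE[OF \<phi>]) measurable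
    have "AE x in lborel. cnj (mval (g * \<phi>) x) = v x * poly ?R (cayley (of_real x))"
      using \<phi> g nz(2) mval_mult[of g \<phi>]
    proof eventually_elim
      case (elim x)
      let ?r = "cayley (complex_of_real x)"
      show ?case
      proof (cases "Q = 0")
        case True
        then show ?thesis
          using elim by (simp add: refl_cnj_poly_def)
      next
        case False
        \<comment> \<open>\<open>nat (- k)\<close> is 0 for nonnegative k, so a nonzero
          \<open>Q\<close> exists only for negative k, where \<open>n = - k\<close> holds without
          truncation.\<close>
        then have n: "1 \<le> n" "k = - int n"
          using Q by (auto simp: n_def)
        have "?r powi k = inverse (?r ^ n)"
          using n by (simp add: power_int_minus)
        \<comment> \<open>One factor turns \<open>1 / (x + \<i>)\<close> into
          \<open>1 / (x - \<i>)\<close>, the weight in \<open>v\<close>; the other n - 1 are those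
          of the reflection.\<close>
        also have "?r ^ n = ?r * ?r ^ (n - 1)"
          using n by (simp flip: power_Suc)
        finally have k: "?r powi k = inverse ?r * inverse (?r ^ (n - 1))"
          by simp
        have "mval (g * \<phi>) x = mval gm x / (of_real x - \<i>) * (poly Q ?r * inverse (?r ^ (n - 1)))"
        proof -
          have "mval (g * \<phi>) x = mval gm x * (inverse ?r * inverse (?r ^ (n - 1))) * mval gp x
              * (inverse (mval gp x) / (of_real x + \<i>) * poly Q ?r)"
            using elim by (simp only: k u_def)
          also have "\<dots> = (mval gp x * inverse (mval gp x)) * (mval gm x * (inverse ?r / (of_real x + \<i>))
              * (poly Q ?r * inverse (?r ^ (n - 1))))"
            by (simp only: divide_inverse mult_ac)
          also have "inverse ?r / (of_real x + \<i>) = 1 / (of_real x - \<i>)"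
            by (simp add: cayley_def)
          finally show ?thesis
            using elim by simp
        qed
        then show ?thesis
          by (simp add: v_def poly_refl_cnj_poly[OF Q] cnj_cayley_of_real power_inverse)
      qed
    qed
    then have minus: "g * \<phi> \<in> hardy_minus p \<longleftrightarrow> (\<exists>F. hardy_bv p (\<lambda>x. v x * poly ?R (cayley (of_real x))) F)"
      unfolding hardy_minus_iff by (rule ex_hardy_bv_cong_AE) measurable
    show ?thesis
      unfolding toeplitz_ker_eq inv_iff gm_iff
      using plus minus hardy_bv_mult_poly_cayley_iff[OF p U, of Q] hardy_bv_mult_poly_cayley_iff[OF p V, of ?R] R1
      by auto
  qed
  show ?thesis
    using representation mem unfolding n_def u_def by blast
qed

text \<open>In the first case every \<open>Q\<close> of admissible degree occurs, in the second only
  those with a zero at 1, and dividing by \<open>r - 1\<close> shortens \<open>K_r\<close> by one.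
  Nonnegative k is included, as \<open>K_r 0\<close> is the span of the empty set.\<close>

lemma toeplitz_ker_cases:
  assumes p: "1 < p" "p \<le> q" and pp: "1 / p + 1 / p' = 1"
    and fact: "pq_factorization q p' g gm k gp"
  shows "gm \<in> cal_hardy_minus p \<and> inverse gp \<in> cal_hardy_plus p \<Longrightarrow>
      toeplitz_ker p g = (\<lambda>f. inverse gp * f) ` K_r (nat (- k))"
    and "\<not> (gm \<in> cal_hardy_minus p \<and> inverse gp \<in> cal_hardy_plus p) \<Longrightarrow>
      toeplitz_ker p g = (\<lambda>f. (inverse gp / xi_plus_i) * f) ` K_r (nat (- k) - 1)"
proof -
  have nz: "AE x in lborel. mval gp x \<noteq> 0"
    using fact by (auto simp: pq_factorization_def nonzero_ae_iff)
  have image_iff: "\<phi> \<in> (\<lambda>f. c * f) ` K_r n \<longleftrightarrow> (\<exists>Q. (Q = 0 \<or> degree Q < n) \<and>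
      (AE x in lborel. mval \<phi> x = mval c x * (poly Q (cayley (of_real x)) / (of_real x + \<i>))))"
    if c: "AE x in lborel. mval c x \<noteq> 0" for \<phi> c n
  proof
    assume "\<phi> \<in> (\<lambda>f. c * f) ` K_r n"
    then obtain f where f: "\<phi> = c * f" "f \<in> K_r n"
      by blast
    from f(2) obtain Q where Q: "Q = 0 \<or> degree Q < n"
      "AE x in lborel. mval f x = poly Q (cayley (of_real x)) / (of_real x + \<i>)"
      unfolding mem_K_r_iff by blast
    have "AE x in lborel. mval \<phi> x = mval c x * (poly Q (cayley (of_real x)) / (of_real x + \<i>))"
      using Q(2) mval_mult[of c f] unfolding f(1) by eventually_elim simp
    with Q(1) show "\<exists>Q. (Q = 0 \<or> degree Q < n) \<and>
      (AE x in lborel. mval \<phi> x = mval c x * (poly Q (cayley (of_real x)) / (of_real x + \<i>)))"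
      by blast
  next
    assume "\<exists>Q. (Q = 0 \<or> degree Q < n) \<and>
      (AE x in lborel. mval \<phi> x = mval c x * (poly Q (cayley (of_real x)) / (of_real x + \<i>)))"
    then obtain Q where Q: "Q = 0 \<or> degree Q < n"
      "AE x in lborel. mval \<phi> x = mval c x * (poly Q (cayley (of_real x)) / (of_real x + \<i>))"
      by blast
    have i: "AE x in lborel. mval (inverse c * \<phi>) x = inverse (mval c x) * mval \<phi> x"
      using mval_mult[of "inverse c" \<phi>] mval_inverse[of c] by eventually_elim simp
    have "AE x in lborel. mval (inverse c * \<phi>) x = poly Q (cayley (of_real x)) / (of_real x + \<i>)"
      using i Q(2) c by eventually_elim simp
    then have "inverse c * \<phi> \<in> K_r n"
      using Q(1) mem_K_r_iff by blast
    moreover have "\<phi> = c * (inverse c * \<phi>)"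
      unfolding mfun_eq_iff using mval_mult[of c "inverse c * \<phi>"] i c by eventually_elim simp
    ultimately show "\<phi> \<in> (\<lambda>f. c * f) ` K_r n"
      by blast
  qed
  have gpi: "AE x in lborel. mval (inverse gp) x = inverse (mval gp x)"
    by (rule mval_inverse)
  have c1: "AE x in lborel. mval (inverse gp) x \<noteq> 0"
    using gpi nz by eventually_elim simp
  have gpx: "AE x in lborel. mval (inverse gp / xi_plus_i) x = inverse (mval gp x) / (of_real x + \<i>)"
    using mval_divide[of "inverse gp" xi_plus_i] gpi mval_xi_plus_i by eventually_elim simp
  have c2: "AE x in lborel. mval (inverse gp / xi_plus_i) x \<noteq> 0"
    using gpx nz by eventually_elim simp
  note ker = mem_toeplitz_ker_iff[OF p pp fact]
  {
    assume A: "gm \<in> cal_hardy_minus p \<and> inverse gp \<in> cal_hardy_plus p"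
    have "(AE x in lborel. mval \<phi> x = inverse (mval gp x) / (of_real x + \<i>) * poly Q (cayley (of_real x))) \<longleftrightarrow>
        (AE x in lborel. mval \<phi> x = mval (inverse gp) x * (poly Q (cayley (of_real x)) / (of_real x + \<i>)))" for \<phi> Q
      by (rule eventually_subst, use gpi in eventually_elim) (simp add: mult_ac)
    then show "toeplitz_ker p g = (\<lambda>f. inverse gp * f) ` K_r (nat (- k))"
      unfolding set_eq_iff ker image_iff[OF c1] by (simp add: A)
  }
  assume B: "\<not> (gm \<in> cal_hardy_minus p \<and> inverse gp \<in> cal_hardy_plus p)"
  let ?n = "nat (- k)"
  show "toeplitz_ker p g = (\<lambda>f. (inverse gp / xi_plus_i) * f) ` K_r (?n - 1)"
  proof (intro set_eqI iffI)
    fix \<phi> assume "\<phi> \<in> toeplitz_ker p g"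
    then obtain Q where Q: "Q = 0 \<or> degree Q < ?n" "poly Q 1 = 0"
      "AE x in lborel. mval \<phi> x = inverse (mval gp x) / (of_real x + \<i>) * poly Q (cayley (of_real x))"
      using B unfolding ker by blast
    from Q(2) obtain P where P: "Q = [:- 1, 1:] * P"
      by (auto simp: poly_eq_0_iff_dvd)
    \<comment> \<open>\<open>Q(r) = (r - 1) * P(r)\<close>: the factor \<open>r - 1\<close> is
      absorbed by the additional weight in \<open>inverse gp / xi_plus_i\<close>, up to the constant
      \<open>- 2 * \<i>\<close>.\<close>
    have "smult (- 2 * \<i>) P = 0 \<or> degree (smult (- 2 * \<i>) P) < ?n - 1"
    proof (cases "P = 0")
      case False
      then have "degree Q = degree P + 1"
        unfolding P by (subst degree_mult_eq) auto
      then show ?thesis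
        using Q(1) by auto
    qed simp
    moreover have "AE x in lborel. mval \<phi> x = mval (inverse gp / xi_plus_i) x
        * (poly (smult (- 2 * \<i>) P) (cayley (of_real x)) / (of_real x + \<i>))"
      using Q(3) gpx
    proof eventually_elim
      case (elim x)
      have "poly Q (cayley (of_real x)) = (cayley (of_real x) - 1) * poly P (cayley (of_real x))"
        unfolding P by (simp add: algebra_simps)
      then show ?case
        using elim by (simp add: cayley_minus_1)
    qed
    ultimately show "\<phi> \<in> (\<lambda>f. (inverse gp / xi_plus_i) * f) ` K_r (?n - 1)"
      unfolding image_iff[OF c2] by blast
  next
    fix \<phi> assume "\<phi> \<in> (\<lambda>f. (inverse gp / xi_plus_i) * f) ` K_r (?n - 1)"
    then obtain P where P: "P = 0 \<or> degree P < ?n - 1"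
      "AE x in lborel. mval \<phi> x = mval (inverse gp / xi_plus_i) x * (poly P (cayley (of_real x)) / (of_real x + \<i>))"
      unfolding image_iff[OF c2] by blast
    \<comment> \<open>\<open>\<i> / 2\<close> is the reciprocal of \<open>- 2 * \<i>\<close>, so
      this undoes the division by \<open>r - 1\<close>.\<close>
    define Q where "Q = smult (\<i> / 2) ([:- 1, 1:] * P)"
    have "Q = 0 \<or> degree Q < ?n"
    proof (cases "P = 0")
      case False
      then have "degree ([:- 1, 1:] * P) = degree P + 1"
        by (subst degree_mult_eq) auto
      then have "degree Q = degree P + 1"
        unfolding Q_def by (subst degree_smult_eq) simp
      then show ?thesis
        using P(1) False by auto
    qed (simp add: Q_def)
    moreover have "poly Q 1 = 0"
      by (simp add: Q_def)
    moreover have "AE x in lborel. mval \<phi> x = inverse (mval gp x) / (of_real x + \<i>) * poly Q (cayley (of_real x))"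
      using P(2) gpx
    proof eventually_elim
      case (elim x)
      have "poly Q (cayley (of_real x)) = \<i> / 2 * ((cayley (of_real x) - 1) * poly P (cayley (of_real x)))"
        unfolding Q_def by (simp add: algebra_simps)
      then show ?case
        using elim by (simp add: cayley_minus_1)
    qed
    ultimately show "\<phi> \<in> toeplitz_ker p g"
      unfolding ker by blast
  qed
qed

theorem theorem7p1:
  fixes p p' q :: real and g gm gp :: mfun and k :: int
  assumes "1 < p" and "p \<le> q" and "1 / p + 1 / p' = 1"
    and "pq_factorization q p' g gm k gp"
  shows "(gm \<in> cal_hardy_minus p \<and> inverse gp \<in> cal_hardy_plus p \<longrightarrow>
            (k \<ge> 0 \<longrightarrow> has_dimension (toeplitz_ker p g) 0) \<and>
            (k < 0 \<longrightarrow> has_dimension (toeplitz_ker p g) (nat \<bar>k\<bar>) \<and>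
                       toeplitz_ker p g = (\<lambda>f. inverse gp * f) ` K_r (nat \<bar>k\<bar>))) \<and>
         (gm \<notin> cal_hardy_minus p \<or> inverse gp \<notin> cal_hardy_plus p \<longrightarrow>
            (k \<ge> -1 \<longrightarrow> has_dimension (toeplitz_ker p g) 0) \<and>
            (k \<le> -2 \<longrightarrow> has_dimension (toeplitz_ker p g) (nat \<bar>k\<bar> - 1) \<and>
                       toeplitz_ker p g =
                         (\<lambda>f. (inverse gp / xi_plus_i) * f) ` K_r (nat \<bar>k\<bar> - 1)))"
proof -
  have nz: "AE x in lborel. mval gp x \<noteq> 0"
    using assms(4) by (auto simp: pq_factorization_def nonzero_ae_iff)
  have "AE x in lborel. mval (inverse gp) x \<noteq> 0"
    using mval_inverse[of gp] nz by eventually_elim simp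
  note dim1 = has_dimension_mult_K_r[OF this]
  have "AE x in lborel. mval (inverse gp / xi_plus_i) x \<noteq> 0"
    using mval_divide[of "inverse gp" xi_plus_i] mval_inverse[of gp] mval_xi_plus_i nz
    by eventually_elim simp
  note dim2 = has_dimension_mult_K_r[OF this]
  note ker = toeplitz_ker_cases[OF assms]
  show ?thesis
  proof (intro conjI impI)
    assume A: "gm \<in> cal_hardy_minus p \<and> inverse gp \<in> cal_hardy_plus p"
    show "has_dimension (toeplitz_ker p g) 0" if "k \<ge> 0"
      using ker(1)[OF A] dim1[of "nat (- k)"] that by simp
    assume k: "k < 0"
    show "has_dimension (toeplitz_ker p g) (nat \<bar>k\<bar>)"
      "toeplitz_ker p g = (\<lambda>f. inverse gp * f) ` K_r (nat \<bar>k\<bar>)"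
      using ker(1)[OF A] dim1[of "nat (- k)"] k by simp_all
  next
    assume "gm \<notin> cal_hardy_minus p \<or> inverse gp \<notin> cal_hardy_plus p"
    then have B: "\<not> (gm \<in> cal_hardy_minus p \<and> inverse gp \<in> cal_hardy_plus p)"
      by blast
    show "has_dimension (toeplitz_ker p g) 0" if "k \<ge> -1"
    proof -
      \<comment> \<open>Truncated subtraction puts k = -1, where the only candidate dimension is
        lost, together with nonnegative k.\<close>
      have "nat (- k) - 1 = 0"
        using that by simp
      then show ?thesis
        using ker(2)[OF B] dim2[of 0] by simp
    qed
    assume k: "k \<le> -2"
    show "has_dimension (toeplitz_ker p g) (nat \<bar>k\<bar> - 1)"
      "toeplitz_ker p g = (\<lambda>f. (inverse gp / xi_plus_i) * f) ` K_r (nat \<bar>k\<bar> - 1)"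
      using ker(2)[OF B] dim2[of "nat (- k) - 1"] k by simp_all
  qed
qed

end
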